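(* Let $$M=\frac{\sqrt{2}(3+\sqrt{3})}{8}\quad\text{and}\quad \lambda=\sqrt 2\,(1-\sqrt M).$$ For any $\tilde\lambda<\lambda$, any $p\geq 1$ and any $t_0>0$, there is a constant $C=C(p,\tilde\lambda,t_0)$ such that, for any probability measures $\nu$ and $\tilde\nu$ on $[0,\infty)$ and any $t\geq t_0$, $$W_p(\nu P_t,\tilde\nu P_t)\leq C\exp\left(-\frac{\tilde\lambda}{p}\,t\right),$$ where $(P_t)_{t\ge 0}$ is the semigroup of the TCP window size process.
   Context: The TCP window size process $X=(X_t)_{t\ge 0}$ is the continuous-time Markov process on $[0,\infty)$ with infinitesimal generator $Lf(x)=f'(x)+x\,(f(x/2)-f(x))$ for smooth $f$. That is, between jumps $X$ increases linearly with slope $1$; jumps occur at rate $X_t$ (so, starting from $x$, the first jump time $T_1$ satisfies $\mathbb P_x(T_1>t)=e^{-t^2/2-xt}$); and at a jump the current position is divided by $2$. Its semigroup is $P_tf(x)=\mathbb E(f(X_t)\mid X_0=x)$, and for a probability measure $\nu$ on $[0,\infty)$, $\nu P_t$ denotes the law of $X_t$ when $X_0$ has law $\nu$. A coupling of two probability measures $\nu,\tilde\nu$ on $\mathbb R$ is a probability measure on $\mathbb R\times\mathbb R$ with marginals $\nu$ and $\tilde\nu$; $\Gamma(\nu,\tilde\nu)$ is the set of all couplings. For $p\ge 1$ and $\nu,\tilde\nu$ with finite $p$-th moment, the Wasserstein distance of order $p$ is $W_p(\nu,\tilde\nu)=\left(\inf_{\Pi\in\Gamma(\nu,\tilde\nu)}\int_{\mathbb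 R^2}|x-y|^p\,\Pi(dx,dy)\right)^{1/p}$. *)

theory Defs
  imports "HOL-Probability.Probability"
begin

section \<open>The TCP window size process\<close>

text \<open>
  The process is built path by path from its initial position \<open>x \<ge> 0\<close> and a sequence \<open>\<omega>\<close> of
  independent standard exponential variables. Starting from \<open>y\<close>, the jump rate integrated up to
  time \<open>t\<close> is \<open>t^2/2 + y t\<close>; the waiting time for the next jump is the time at which it reaches the
  current exponential variable \<open>e\<close>. See \<open>tcp_wait_survival\<close> for the resulting law.
\<close>

definition tcp_wait :: "real \<Rightarrow> real \<Rightarrow> real" where
  "tcp_wait y e = sqrt (y\<^sup>2 + 2 * e) - y"

definition tcp_noise :: "real stream measure" where
  "tcp_noise = stream_space (density lborel (exponential_density 1))"

text \<open>Position just after the \<open>n\<close>-th jump.\<close>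

primrec tcp_post :: "real \<Rightarrow> real stream \<Rightarrow> nat \<Rightarrow> real" where
  "tcp_post x \<omega> 0 = x"
| "tcp_post x \<omega> (Suc n) = (tcp_post x \<omega> n + tcp_wait (tcp_post x \<omega> n) (\<omega> !! n)) / 2"

definition tcp_jump_time :: "real \<Rightarrow> real stream \<Rightarrow> nat \<Rightarrow> real" where
  "tcp_jump_time x \<omega> n = (\<Sum>k<n. tcp_wait (tcp_post x \<omega> k) (\<omega> !! k))"

text \<open>
  If the jump times stay bounded by \<open>t\<close>, \<open>LEAST\<close> is an unspecified number. This affects only a null
  set: up to time \<open>t\<close> the position, and hence the jump rate, is at most \<open>x + t\<close>.
\<close>

definition tcp_jumps :: "real \<Rightarrow> real stream \<Rightarrow> real \<Rightarrow> nat" where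
  "tcp_jumps x \<omega> t = (LEAST n. t < tcp_jump_time x \<omega> (Suc n))"

definition tcp_path :: "real \<Rightarrow> real stream \<Rightarrow> real \<Rightarrow> real" where
  "tcp_path x \<omega> t =
     (let n = tcp_jumps x \<omega> t in tcp_post x \<omega> n + (t - tcp_jump_time x \<omega> n))"

text \<open>\<open>tcp_law \<nu> t\<close> is \<open>\<nu> P\<^sub>t\<close>: the law at time \<open>t\<close> when the initial position has law \<open>\<nu>\<close> and is
  independent of the noise.\<close>

definition tcp_law :: "real measure \<Rightarrow> real \<Rightarrow> real measure" where
  "tcp_law \<nu> t = distr (\<nu> \<Otimes>\<^sub>M tcp_noise) borel (\<lambda>(x, \<omega>). tcp_path x \<omega> t)"

text \<open>A probability measure on \<open>[0,\<infinity>)\<close>, seen as a Borel measure on the real line.\<close>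

definition prob_on_nonneg :: "real measure \<Rightarrow> bool" where
  "prob_on_nonneg \<nu> \<longleftrightarrow> prob_space \<nu> \<and> sets \<nu> = sets borel \<and> (AE x in \<nu>. 0 \<le> x)"


section \<open>Wasserstein distances\<close>

definition couplings :: "real measure \<Rightarrow> real measure \<Rightarrow> (real \<times> real) measure set" where
  "couplings \<mu> \<mu>' = {\<pi>. prob_space \<pi> \<and> sets \<pi> = sets (borel \<Otimes>\<^sub>M borel) \<and>
     distr \<pi> borel fst = \<mu> \<and> distr \<pi> borel snd = \<mu>'}"

text \<open>
  The value lies in \<open>[0,\<infinity>]\<close>, with \<open>\<infinity>\<close> when every coupling has infinite cost, so that an upper
  bound is never satisfied through the value \<open>0\<close> of a non-integrable Bochner integral.
\<close>

definition wasserstein :: "real \<Rightarrow> real measure \<Rightarrow> real measure \<Rightarrow> ennreal" where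
  "wasserstein p \<mu> \<mu>' =
     (let c = (INF \<pi>\<in>couplings \<mu> \<mu>'. \<integral>\<^sup>+(x, y). ennreal (\<bar>x - y\<bar> powr p) \<partial>\<pi>)
      in if c = \<infinity> then \<infinity> else ennreal (enn2real c powr (1 / p)))"


section \<open>Sanity checks\<close>

lemma tcp_wait_integrated_rate:
  assumes "0 \<le> x" "0 \<le> e"
  shows "0 \<le> tcp_wait x e" "x * tcp_wait x e + (tcp_wait x e)\<^sup>2 / 2 = e"
proof -
  have "x \<le> sqrt (x\<^sup>2 + 2 * e)"
    using assms by (intro real_le_rsqrt) auto
  then show "0 \<le> tcp_wait x e"
    by (simp add: tcp_wait_def)
  have "(sqrt (x\<^sup>2 + 2 * e))\<^sup>2 = x\<^sup>2 + 2 * e"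
    using assms by simp
  then show "x * tcp_wait x e + (tcp_wait x e)\<^sup>2 / 2 = e"
    unfolding tcp_wait_def power2_diff by (simp add: power2_eq_square field_simps)
qed

lemma tcp_wait_greater_iff:
  assumes "0 \<le> x" "0 \<le> t"
  shows "t < tcp_wait x e \<longleftrightarrow> t\<^sup>2 / 2 + x * t < e"
proof -
  have "t < tcp_wait x e \<longleftrightarrow> x + t < sqrt (x\<^sup>2 + 2 * e)"
    by (auto simp: tcp_wait_def)
  also have "\<dots> \<longleftrightarrow> sqrt ((x + t)\<^sup>2) < sqrt (x\<^sup>2 + 2 * e)"
    using assms by simp
  also have "\<dots> \<longleftrightarrow> t\<^sup>2 / 2 + x * t < e"
    by (simp only: real_sqrt_less_iff) (auto simp: power2_eq_square algebra_simps)
  finally show ?thesis .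
qed

lemma tcp_wait_survival:
  assumes "0 \<le> x" "0 \<le> t"
  shows "measure (density lborel (exponential_density 1)) {e. t < tcp_wait x e}
           = exp (- (t\<^sup>2 / 2) - x * t)"
proof -
  interpret E: prob_space "density lborel (exponential_density 1)"
    by (rule prob_space_exponential_density) simp
  have "distributed (density lborel (exponential_density 1)) lborel (\<lambda>e. e) (exponential_density 1)"
    by (auto simp: distributed_def distr_id2 exponential_density_nonneg)
  then have "measure (density lborel (exponential_density 1))
      {e \<in> space (density lborel (exponential_density 1)). t\<^sup>2 / 2 + x * t < e}
        = exp (- (t\<^sup>2 / 2 + x * t) * 1)"
    using assms by (intro E.exponential_distributedD_gt) auto
  then show ?thesis
    using assms by (simp add: tcp_wait_greater_iff)
qed

lemma prob_space_tcp_noise: "prob_space tcp_noise"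
  unfolding tcp_noise_def
  by (intro prob_space.prob_space_stream_space prob_space_exponential_density) simp

lemma measurable_tcp_noise_snth [measurable]: "(\<lambda>\<omega>. \<omega> !! n) \<in> borel_measurable tcp_noise"
proof -
  have "(\<lambda>\<omega>. \<omega> !! n) \<in> tcp_noise \<rightarrow>\<^sub>M density lborel (exponential_density 1)"
    unfolding tcp_noise_def by (rule measurable_snth)
  then show ?thesis by simp
qed

lemma measurable_tcp_post [measurable]:
  "(\<lambda>(x, \<omega>). tcp_post x \<omega> n) \<in> borel_measurable (borel \<Otimes>\<^sub>M tcp_noise)"
  by (induction n) (simp_all add: tcp_wait_def split_beta')

lemma measurable_tcp_jump_time [measurable]:
  "(\<lambda>(x, \<omega>). tcp_jump_time x \<omega> n) \<in> borel_measurable (borel \<Otimes>\<^sub>M tcp_noise)"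
  unfolding tcp_jump_time_def tcp_wait_def by simp

lemma measurable_tcp_path [measurable]:
  "(\<lambda>(x, \<omega>). tcp_path x \<omega> t) \<in> borel_measurable (borel \<Otimes>\<^sub>M tcp_noise)"
proof -
  have [measurable]: "(\<lambda>(x, \<omega>). tcp_jumps x \<omega> t) \<in> borel \<Otimes>\<^sub>M tcp_noise \<rightarrow>\<^sub>M count_space UNIV"
    unfolding tcp_jumps_def split_beta' by measurable
  have "(\<lambda>z. (\<lambda>n z. tcp_post (fst z) (snd z) n + (t - tcp_jump_time (fst z) (snd z) n))
      (tcp_jumps (fst z) (snd z) t) z) \<in> borel_measurable (borel \<Otimes>\<^sub>M tcp_noise)"
    by (rule measurable_compose_countable) measurable
  then show ?thesis
    by (simp add: tcp_path_def Let_def split_beta')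
qed

lemma prob_space_tcp_law:
  assumes "prob_on_nonneg \<nu>"
  shows "prob_space (tcp_law \<nu> t)"
proof -
  interpret N: prob_space \<nu> using assms by (simp add: prob_on_nonneg_def)
  interpret W: prob_space tcp_noise by (rule prob_space_tcp_noise)
  interpret pair_prob_space \<nu> tcp_noise ..
  have "sets (\<nu> \<Otimes>\<^sub>M tcp_noise) = sets (borel \<Otimes>\<^sub>M tcp_noise)"
    using assms by (intro sets_pair_measure_cong) (simp_all add: prob_on_nonneg_def)
  then have "(\<lambda>(x, \<omega>). tcp_path x \<omega> t) \<in> borel_measurable (\<nu> \<Otimes>\<^sub>M tcp_noise)"
    using measurable_tcp_path measurable_cong_sets by blast
  then show ?thesis
    unfolding tcp_law_def by (rule prob_space_distr)
qed

end

theory Submission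
  imports Defs
begin

text \<open>
  Let both coordinates propose jumps at the rate \<open>m = max x y\<close> with a common uniform mark, so that the
  smaller one jumps only together with the larger one. Each proposal multiplies the mean of
  \<open>sqrt \<bar>x - y\<bar>\<close> by at most \<open>M\<close>, hence this mean decays at the instantaneous rate \<open>(1 - M) m\<close>.
  The weight \<open>exp (- \<mu> min m (7 / 5))\<close> transfers the decay to the times where \<open>m\<close> is small: the weighted
  cost is a supersolution decaying at the constant rate \<open>\<mu> = 121 / 1000 \<ge> \<kappa>\<close>.
  The couplings used are exact but truncated: after finitely many proposals the coordinates
  continue independently. All equalities of laws and all bounds reduce to the renewal equation of
  the first jump, iterated, since \<open>n\<close> jumps at rate at most \<open>B\<close> before time \<open>t\<close> have probability at most
  \<open>(B t)^n / n!\<close>. The process comes down from infinity, so all moments at time \<open>t\<^sub>0\<close> are bounded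
  uniformly in the initial law; this starts the contraction and interpolates from \<open>sqrt \<bar>x - y\<bar>\<close>
  to \<open>\<bar>x - y\<bar>^p\<close>.
\<close>

text \<open>The square root is forced by the geometry of the coupling. Let the coordinates be
  \<open>b\<close> and \<open>b + d\<close> at a proposal. The larger one jumps alone with
  probability d / (b + d), and the distance then becomes |d - b| / 2. For d much smaller than b this
  rare event costs about d / 2 in mean, as much as the remaining distance after a common jump, so
  the mean of |x - y| has no contraction factor below 1. Under the square root the rare event costs
  only about sqrt (d / (2 b)) times sqrt d, which is negligible, and the common jump gains 1 / sqrt
  2. The weight exploits that the distance stays constant between proposals while the larger
  coordinate grows with slope 1: near 0, where proposals are too rare, the decay comes from the
  falling weight. The price is paid at a proposal, when halving the larger coordinate raises the
  weight again. Cutting the weight off at 7 / 5 caps this price at exp (\<mu> * 7 / 10); beyond the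
  cutoff proposals are frequent enough to produce the rate \<mu> alone.\<close>

abbreviation std_exponential :: "real measure" where
  "std_exponential \<equiv> density lborel (exponential_density 1)"

interpretation std_exponential: prob_space std_exponential
  by (rule prob_space_exponential_density) simp

interpretation tcp_noise: prob_space tcp_noise
  by (rule prob_space_tcp_noise)

lemma space_tcp_noise [simp]: "space tcp_noise = UNIV"
  by (simp add: tcp_noise_def space_stream_space)

lemma AE_std_exponential_nonneg: "AE e in std_exponential. 0 \<le> e"
  by (subst AE_density) (auto simp: exponential_density_def)

section \<open>The law of the waiting time between jumps\<close>

definition hazard :: "real \<Rightarrow> real \<Rightarrow> real" where
  "hazard x t = t\<^sup>2 / 2 + x * t"

definition wait_density :: "real \<Rightarrow> real \<Rightarrow> real" where
  "wait_density x s = (x + s) * exp (- hazard x s)"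

lemma measurable_hazard [measurable]: "(\<lambda>(x, s). hazard x s) \<in> borel_measurable (borel \<Otimes>\<^sub>M borel)"
  unfolding hazard_def split_beta' by measurable

lemma measurable_wait_density [measurable]:
  "(\<lambda>(x, s). wait_density x s) \<in> borel_measurable (borel \<Otimes>\<^sub>M borel)"
  unfolding wait_density_def hazard_def split_beta' by measurable

lemma measurable_tcp_wait [measurable]:
  "(\<lambda>(x, s). tcp_wait x s) \<in> borel_measurable (borel \<Otimes>\<^sub>M borel)"
  unfolding tcp_wait_def split_beta' by measurable

lemma hazard_0 [simp]: "hazard x 0 = 0"
  by (simp add: hazard_def)

lemma hazard_nonneg: "0 \<le> x \<Longrightarrow> 0 \<le> t \<Longrightarrow> 0 \<le> hazard x t"
  by (simp add: hazard_def)

lemma wait_density_nonneg: "0 \<le> x \<Longrightarrow> 0 \<le> s \<Longrightarrow> 0 \<le> wait_density x s"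
  by (simp add: wait_density_def)

lemma wait_density_le: "0 \<le> x \<Longrightarrow> 0 \<le> s \<Longrightarrow> wait_density x s \<le> x + s"
  unfolding wait_density_def using hazard_nonneg[of x s]
  by (intro mult_left_le) auto

text \<open>The rate at time \<open>s\<close> depends on \<open>x\<close> and \<open>s\<close> only
  through \<open>x + s\<close>, so surviving \<open>r\<close> without a jump amounts to restarting
  from \<open>x + r\<close>. This is the Markov property along a flow line.\<close>

lemma hazard_add: "hazard x (r + s) = hazard x r + hazard (x + r) s"
  by (simp add: hazard_def power2_eq_square field_simps)

lemma has_derivative_exp_hazard:
  "((\<lambda>s. - exp (- hazard x s)) has_real_derivative wait_density x s) (at s)"
  unfolding hazard_def wait_density_def
  by (auto intro!: derivative_eq_intros simp: algebra_simps)

lemma tendsto_exp_hazard: "0 \<le> x \<Longrightarrow> ((\<lambda>s. - exp (- hazard x s)) \<longlongrightarrow> 0) at_top"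
proof -
  assume "0 \<le> x"
  have "filterlim (\<lambda>s. hazard x s) at_top at_top"
  proof (rule filterlim_at_top_mono[OF filterlim_ident])
    show "\<forall>\<^sub>F s in at_top. s \<le> hazard x s"
      using eventually_ge_at_top[of 2]
    proof eventually_elim
      case (elim s)
      have "2 * s \<le> s * s" using elim by (intro mult_right_mono) auto
      moreover have "0 \<le> x * s" using elim \<open>0 \<le> x\<close> by simp
      ultimately show ?case by (simp add: hazard_def power2_eq_square)
    qed
  qed
  then have "((\<lambda>s. exp (- hazard x s)) \<longlongrightarrow> 0) at_top"
    by (intro filterlim_compose[OF exp_at_bot] filterlim_compose[OF filterlim_uminus_at_bot_at_top])
  then show ?thesis
    using tendsto_minus by fastforce
qed

lemma nn_integral_wait_density:
  assumes "0 \<le> x" "0 \<le> r"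
  shows "(\<integral>\<^sup>+s. ennreal (wait_density x s) * indicator {r..} s \<partial>lborel) = ennreal (exp (- hazard x r))"
  using assms nn_integral_FTC_atLeast[of "wait_density x" r "\<lambda>s. - exp (- hazard x s)" 0]
  by (simp add: has_derivative_exp_hazard tendsto_exp_hazard wait_density_nonneg)

lemma distr_tcp_wait:
  assumes x: "0 \<le> x"
  shows "distr std_exponential borel (tcp_wait x) =
    density lborel (\<lambda>s. ennreal (wait_density x s) * indicator {0..} s)"
proof (rule measure_eqI_lessThan)
  fix a :: real
  have em: "emeasure (distr std_exponential borel (tcp_wait x)) {a<..} =
    emeasure std_exponential {e. a < tcp_wait x e}" for a
    by (subst emeasure_distr) (auto simp: vimage_def)
  show "emeasure (distr std_exponential borel (tcp_wait x)) {a<..} < \<infinity>"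
    by (simp add: em std_exponential.emeasure_eq_measure)
  have "emeasure std_exponential {e. a < tcp_wait x e} = ennreal (exp (- hazard x (max 0 a)))"
  proof (cases "0 \<le> a")
    case True
    then show ?thesis using tcp_wait_survival[OF x True]
      by (simp add: std_exponential.emeasure_eq_measure hazard_def)
  next
    case False
    have "AE e in std_exponential. a < tcp_wait x e"
      using AE_std_exponential_nonneg
      by eventually_elim (use False x tcp_wait_integrated_rate(1) in fastforce)
    then show ?thesis using False
      by (subst std_exponential.emeasure_eq_1_AE) auto
  qed
  also have "\<dots> = (\<integral>\<^sup>+s. ennreal (wait_density x s) * indicator {max 0 a..} s \<partial>lborel)"
    using x by (subst nn_integral_wait_density) auto
  also have "\<dots> = (\<integral>\<^sup>+s. ennreal (wait_density x s) * indicator {0..} s * indicator {a<..} s \<partial>lborel)"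
    using AE_lborel_singleton[of a] by (intro nn_integral_cong_AE) (auto split: split_indicator)
  also have "\<dots> = emeasure (density lborel (\<lambda>s. ennreal (wait_density x s) * indicator {0..} s)) {a<..}"
    by (subst emeasure_density) auto
  finally show "emeasure (distr std_exponential borel (tcp_wait x)) {a<..} =
    emeasure (density lborel (\<lambda>s. ennreal (wait_density x s) * indicator {0..} s)) {a<..}"
    by (simp add: em)
qed auto

text \<open>Common source of the renewal equations of the process and of the coupling: either no
  jump occurs up to \<open>t\<close>, with fixed payoff \<open>c\<close>, or the first one occurs at
  some \<open>s\<close> in [0, t].\<close>

lemma nn_integral_tcp_wait:
  assumes "0 \<le> x" "0 \<le> t" and [measurable]: "g \<in> borel_measurable borel"
  shows "(\<integral>\<^sup>+e. (if t < tcp_wait x e then c else g (tcp_wait x e)) \<partial>std_exponential) =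
    c * ennreal (exp (- hazard x t)) +
    (\<integral>\<^sup>+s. ennreal (wait_density x s) * g s * indicator {0..t} s \<partial>lborel)"
proof -
  have "(\<integral>\<^sup>+e. (if t < tcp_wait x e then c else g (tcp_wait x e)) \<partial>std_exponential) =
    (\<integral>\<^sup>+s. (if t < s then c else g s) \<partial>distr std_exponential borel (tcp_wait x))"
    by (subst nn_integral_distr) auto
  also have "\<dots> = (\<integral>\<^sup>+s. ennreal (wait_density x s) * indicator {0..} s * (if t < s then c else g s) \<partial>lborel)"
    by (simp add: distr_tcp_wait[OF \<open>0 \<le> x\<close>] nn_integral_density)
  also have "\<dots> = (\<integral>\<^sup>+s. c * (ennreal (wait_density x s) * indicator {t..} s) +
      ennreal (wait_density x s) * g s * indicator {0..t} s \<partial>lborel)"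
    using AE_lborel_singleton[of t] \<open>0 \<le> t\<close>
    by (intro nn_integral_cong_AE) (auto split: split_indicator simp: mult_ac)
  also have "\<dots> = c * (\<integral>\<^sup>+s. ennreal (wait_density x s) * indicator {t..} s \<partial>lborel) +
    (\<integral>\<^sup>+s. ennreal (wait_density x s) * g s * indicator {0..t} s \<partial>lborel)"
    by (subst nn_integral_add) (auto simp: nn_integral_cmult)
  finally show ?thesis
    using assms by (simp add: nn_integral_wait_density)
qed

section \<open>Paths\<close>

text \<open>Measurability jointly with the time, because after the first jump the path is evaluated
  at the random remaining time.\<close>

lemma measurable_tcp_path_time [measurable]:
  "(\<lambda>(t, x, \<omega>). tcp_path x \<omega> t) \<in> borel_measurable (borel \<Otimes>\<^sub>M borel \<Otimes>\<^sub>M tcp_noise)"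
proof -
  have [measurable]: "(\<lambda>z. tcp_jumps (fst (snd z)) (snd (snd z)) (fst z)) \<in> borel \<Otimes>\<^sub>M borel \<Otimes>\<^sub>M tcp_noise \<rightarrow>\<^sub>M count_space UNIV"
    unfolding tcp_jumps_def by measurable
  have "(\<lambda>z. (\<lambda>n z. tcp_post (fst (snd z)) (snd (snd z)) n
      + (fst z - tcp_jump_time (fst (snd z)) (snd (snd z)) n))
      (tcp_jumps (fst (snd z)) (snd (snd z)) (fst z)) z) \<in> borel_measurable (borel \<Otimes>\<^sub>M borel \<Otimes>\<^sub>M tcp_noise)"
    by (rule measurable_compose_countable) measurable
  then show ?thesis
    by (simp add: tcp_path_def Let_def split_beta')
qed

lemma tcp_post_Stream:
  "tcp_post x (e ## \<omega>) (Suc n) = tcp_post ((x + tcp_wait x e) / 2) \<omega> n"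
  by (induction n) simp_all

lemma tcp_jump_time_Stream:
  "tcp_jump_time x (e ## \<omega>) (Suc n) = tcp_wait x e + tcp_jump_time ((x + tcp_wait x e) / 2) \<omega> n"
  unfolding tcp_jump_time_def sum.lessThan_Suc_shift by (simp add: tcp_post_Stream del: tcp_post.simps(2))

lemma tcp_path_Stream_before:
  assumes "t < tcp_wait x e"
  shows "tcp_path x (e ## \<omega>) t = x + t"
proof -
  have "tcp_jumps x (e ## \<omega>) t = 0"
    unfolding tcp_jumps_def using assms by (intro Least_equality) (auto simp: tcp_jump_time_def)
  then show ?thesis
    by (simp add: tcp_path_def tcp_jump_time_def)
qed

text \<open>Assumption \<open>ex\<close> excludes explosion of the shifted path. Without it both
  \<open>LEAST\<close> expressions are unspecified numbers, which need not differ by one.\<close>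

lemma tcp_path_Stream_after:
  assumes "tcp_wait x e \<le> t"
    and ex: "\<exists>n. t - tcp_wait x e < tcp_jump_time ((x + tcp_wait x e) / 2) \<omega> n"
  shows "tcp_path x (e ## \<omega>) t = tcp_path ((x + tcp_wait x e) / 2) \<omega> (t - tcp_wait x e)"
proof -
  let ?s = "tcp_wait x e" and ?y = "(x + tcp_wait x e) / 2"
  obtain n where "t - ?s < tcp_jump_time ?y \<omega> n" using ex by blast
  moreover from this assms(1) have "n \<noteq> 0"
    by (auto simp: tcp_jump_time_def intro!: gr0I)
  ultimately obtain n where n: "t - ?s < tcp_jump_time ?y \<omega> (Suc n)"
    using not0_implies_Suc by blast
  have "tcp_jumps x (e ## \<omega>) t = Suc (LEAST n. t < tcp_jump_time x (e ## \<omega>) (Suc (Suc n)))"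
    unfolding tcp_jumps_def
    by (rule Least_Suc[of _ "Suc n"])
      (use n assms(1) in \<open>auto simp: tcp_jump_time_Stream, simp add: tcp_jump_time_def\<close>)
  also have "(LEAST n. t < tcp_jump_time x (e ## \<omega>) (Suc (Suc n))) = tcp_jumps ?y \<omega> (t - ?s)"
    unfolding tcp_jumps_def tcp_jump_time_Stream[of _ _ _ "Suc _"] by (simp add: algebra_simps)
  finally have "tcp_jumps x (e ## \<omega>) t = Suc (tcp_jumps ?y \<omega> (t - ?s))" .
  then show ?thesis
    by (simp add: tcp_path_def Let_def tcp_jump_time_Stream tcp_post_Stream del: tcp_post.simps(2))
qed

section \<open>Absence of explosion\<close>

lemma tcp_post_bounds:
  assumes "0 \<le> x" "\<And>n. 0 \<le> \<omega> !! n"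
  shows "0 \<le> tcp_post x \<omega> n \<and> tcp_post x \<omega> n \<le> x + tcp_jump_time x \<omega> n"
proof (induction n)
  case (Suc n)
  then have "0 \<le> tcp_wait (tcp_post x \<omega> n) (\<omega> !! n)"
    using assms by (intro tcp_wait_integrated_rate) auto
  with Suc show ?case by (auto simp: tcp_jump_time_def)
qed (use assms in \<open>simp add: tcp_jump_time_def\<close>)

text \<open>If the jump times stay below \<open>t\<close>, so do the positions below \<open>x + t\<close>, which bounds every
  integrated rate \<open>\<omega> !! k\<close>; so one large exponential variable is enough to exclude explosion.\<close>

lemma tcp_jump_time_exceeds:
  assumes x: "0 \<le> x" and \<omega>: "\<And>n. 0 \<le> \<omega> !! n" and big: "(x + t) * t + t\<^sup>2 / 2 < \<omega> !! k"
  shows "\<exists>n. t < tcp_jump_time x \<omega> n"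
proof (rule ccontr)
  assume "\<not> ?thesis"
  then have le: "tcp_jump_time x \<omega> n \<le> t" for n by (simp add: not_less)
  let ?y = "tcp_post x \<omega> k" and ?w = "tcp_wait (tcp_post x \<omega> k) (\<omega> !! k)"
  note b = tcp_post_bounds[of x \<omega>, OF x \<omega>]
  have w: "0 \<le> ?w" and rate: "?y * ?w + ?w\<^sup>2 / 2 = \<omega> !! k"
    using b[of k] \<omega> by (intro tcp_wait_integrated_rate; simp)+
  have "0 \<le> tcp_jump_time x \<omega> k"
    unfolding tcp_jump_time_def using b \<omega> by (intro sum_nonneg tcp_wait_integrated_rate) auto
  moreover have "tcp_jump_time x \<omega> (Suc k) = tcp_jump_time x \<omega> k + ?w"
    by (simp add: tcp_jump_time_def)
  ultimately have "?w \<le> t" using le[of "Suc k"] by simp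
  moreover have "?y \<le> x + t" using b[of k] le[of k] by simp
  ultimately have "?y * ?w + ?w\<^sup>2 / 2 \<le> (x + t) * t + t\<^sup>2 / 2"
    using w b[of k] by (intro add_mono mult_mono divide_right_mono power_mono) auto
  with rate big show False by simp
qed

lemma AE_tcp_noise_nonneg: "AE \<omega> in tcp_noise. \<forall>n. 0 \<le> \<omega> !! n"
proof -
  have "AE \<omega> in tcp_noise. stream_all ((\<le>) 0) \<omega>"
    unfolding tcp_noise_def
    by (rule std_exponential.AE_stream_all[OF _ AE_std_exponential_nonneg]) simp
  then show ?thesis
    by (simp add: stream_all_iff sset_range)
qed

lemma emeasure_std_exponential_atMost_less_1: "emeasure std_exponential {..c} < 1"
proof -
  \<comment> \<open>From position 0 the waiting time is \<open>sqrt (2 * e)\<close>, so the known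
    survival function of the wait yields the tail of \<open>e\<close> beyond
    \<open>c\<close>.\<close>
  have "0 < measure std_exponential {e. sqrt (2 * max 0 c) < tcp_wait 0 e}"
    by (subst tcp_wait_survival) auto
  also have "\<dots> \<le> measure std_exponential (space std_exponential - {..c})"
    by (intro std_exponential.finite_measure_mono) (auto simp: tcp_wait_greater_iff)
  also have "\<dots> = 1 - measure std_exponential {..c}"
    by (intro std_exponential.prob_compl) auto
  finally show ?thesis
    by (simp add: std_exponential.emeasure_eq_measure)
qed

text \<open>Splitting off the first variable shows that the event of staying below \<open>c\<close>
  forever has a probability \<open>a\<close> with \<open>a = a * q\<close>, where
  \<open>q < 1\<close> is the probability that one variable is at most \<open>c\<close>. Hence
  \<open>a = 0\<close>.\<close>

lemma AE_tcp_noise_unbounded: "AE \<omega> in tcp_noise. \<exists>n. c < \<omega> !! n"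
proof -
  let ?A = "{\<omega>. \<forall>n. \<omega> !! n \<le> c}"
  have A [measurable]: "?A \<in> sets tcp_noise"
  proof -
    have "{\<omega> \<in> space tcp_noise. \<forall>n. \<omega> !! n \<le> c} \<in> sets tcp_noise" by measurable
    then show ?thesis by simp
  qed
  have "emeasure tcp_noise ?A = (\<integral>\<^sup>+e. emeasure tcp_noise {\<omega>\<in>space tcp_noise. e ## \<omega> \<in> ?A} \<partial>std_exponential)"
    using std_exponential.emeasure_stream_space[of ?A] A by (simp add: tcp_noise_def)
  also have "\<dots> = (\<integral>\<^sup>+e. emeasure tcp_noise ?A * indicator {..c} e \<partial>std_exponential)"
  proof (intro nn_integral_cong)
    fix e
    have "{\<omega>. e ## \<omega> \<in> ?A} = (if e \<le> c then ?A else {})"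
      by (auto simp: Stream_snth split: nat.splits)
    then show "emeasure tcp_noise {\<omega>\<in>space tcp_noise. e ## \<omega> \<in> ?A} = emeasure tcp_noise ?A * indicator {..c} e"
      by simp
  qed
  also have "\<dots> = emeasure tcp_noise ?A * emeasure std_exponential {..c}"
    by (subst nn_integral_cmult_indicator) auto
  finally have eq: "measure tcp_noise ?A = measure tcp_noise ?A * measure std_exponential {..c}"
    by (simp add: tcp_noise.emeasure_eq_measure std_exponential.emeasure_eq_measure flip: ennreal_mult)
  have "measure std_exponential {..c} < 1"
    using emeasure_std_exponential_atMost_less_1[of c] by (simp add: std_exponential.emeasure_eq_measure)
  with eq have "measure tcp_noise ?A = 0"
    by (metis mult_cancel_left1 less_irrefl)
  then have "?A \<in> null_sets tcp_noise"
    by (auto simp: null_sets_def tcp_noise.emeasure_eq_measure)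
  then show ?thesis
    by (rule AE_I') (auto simp: not_less)
qed

lemma AE_tcp_jump_time_exceeds:
  assumes "0 \<le> x"
  shows "AE \<omega> in tcp_noise. \<exists>n. t < tcp_jump_time x \<omega> n"
  using AE_tcp_noise_nonneg AE_tcp_noise_unbounded[of "(x + t) * t + t\<^sup>2 / 2"]
  by eventually_elim (use tcp_jump_time_exceeds[OF assms] in blast)

text \<open>The slope is 1 and jumps only lower the position. This confines the process to a bounded
  region up to time \<open>t\<close>, where locally bounded functions and the jump rate are
  bounded.\<close>

lemma AE_tcp_path_bounds:
  assumes "0 \<le> x" "0 \<le> t"
  shows "AE \<omega> in tcp_noise. 0 \<le> tcp_path x \<omega> t \<and> tcp_path x \<omega> t \<le> x + t"
  using AE_tcp_noise_nonneg AE_tcp_jump_time_exceeds[OF assms(1), of t]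
proof eventually_elim
  case (elim \<omega>)
  note b = tcp_post_bounds[of x \<omega> "tcp_jumps x \<omega> t", OF assms(1)]
  have "tcp_jump_time x \<omega> (tcp_jumps x \<omega> t) \<le> t"
  proof (cases "tcp_jumps x \<omega> t")
    case (Suc n)
    then have "\<not> t < tcp_jump_time x \<omega> (Suc n)"
      using not_less_Least[of n "\<lambda>n. t < tcp_jump_time x \<omega> (Suc n)"] unfolding tcp_jumps_def by simp
    then show ?thesis using Suc by simp
  qed (use assms in \<open>simp add: tcp_jump_time_def\<close>)
  then show ?case using b elim by (simp add: tcp_path_def Let_def)
qed

section \<open>The semigroup and its renewal equation\<close>

definition tcp_semigroup :: "(real \<Rightarrow> ennreal) \<Rightarrow> real \<Rightarrow> real \<Rightarrow> ennreal" where
  "tcp_semigroup f t x = (\<integral>\<^sup>+\<omega>. f (tcp_path x \<omega> t) \<partial>tcp_noise)"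

lemma measurable_tcp_semigroup [measurable]:
  assumes [measurable]: "f \<in> borel_measurable borel"
  shows "(\<lambda>(t, x). tcp_semigroup f t x) \<in> borel_measurable (borel \<Otimes>\<^sub>M borel)"
proof -
  have "(\<lambda>z. (fst (fst z), snd (fst z), snd z)) \<in> (borel \<Otimes>\<^sub>M borel) \<Otimes>\<^sub>M tcp_noise \<rightarrow>\<^sub>M borel \<Otimes>\<^sub>M borel \<Otimes>\<^sub>M tcp_noise"
    by measurable
  from measurable_compose[OF this measurable_tcp_path_time]
  have [measurable]: "(\<lambda>z. tcp_path (snd (fst z)) (snd z) (fst (fst z))) \<in> borel_measurable ((borel \<Otimes>\<^sub>M borel) \<Otimes>\<^sub>M tcp_noise)"
    by (simp add: split_beta')
  show ?thesis
    unfolding tcp_semigroup_def split_beta'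
    by (rule tcp_noise.borel_measurable_nn_integral) (simp add: split_beta')
qed

text \<open>Condition on the first exponential variable. Shifting the stream restarts the process
  outside the null set of exploding paths, and \<open>nn_integral_tcp_wait\<close> turns the
  variable into the first jump time.\<close>

lemma tcp_semigroup_renewal:
  assumes x: "0 \<le> x" and t: "0 \<le> t" and f [measurable]: "f \<in> borel_measurable borel"
  shows "tcp_semigroup f t x = f (x + t) * ennreal (exp (- hazard x t)) +
    (\<integral>\<^sup>+s. ennreal (wait_density x s) * tcp_semigroup f (t - s) ((x + s) / 2) * indicator {0..t} s \<partial>lborel)"
proof -
  have [measurable]: "(\<lambda>\<omega>. tcp_path x \<omega> t) \<in> borel_measurable tcp_noise"
    by measurable
  have "tcp_semigroup f t x = (\<integral>\<^sup>+e. \<integral>\<^sup>+\<omega>. f (tcp_path x (e ## \<omega>) t) \<partial>tcp_noise \<partial>std_exponential)"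
    unfolding tcp_semigroup_def
    using std_exponential.nn_integral_stream_space[of "\<lambda>\<omega>. f (tcp_path x \<omega> t)"]
    by (simp add: tcp_noise_def[symmetric])
  also have "\<dots> = (\<integral>\<^sup>+e. (if t < tcp_wait x e then f (x + t)
      else tcp_semigroup f (t - tcp_wait x e) ((x + tcp_wait x e) / 2)) \<partial>std_exponential)"
  proof (rule nn_integral_cong_AE)
    show "AE e in std_exponential. (\<integral>\<^sup>+\<omega>. f (tcp_path x (e ## \<omega>) t) \<partial>tcp_noise) =
      (if t < tcp_wait x e then f (x + t)
       else tcp_semigroup f (t - tcp_wait x e) ((x + tcp_wait x e) / 2))"
      using AE_std_exponential_nonneg
    proof eventually_elim
      case (elim e)
      have w: "0 \<le> tcp_wait x e"
        using x elim by (rule tcp_wait_integrated_rate)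
      show ?case
      proof (cases "t < tcp_wait x e")
        case False
        have "AE \<omega> in tcp_noise. \<exists>n. t - tcp_wait x e < tcp_jump_time ((x + tcp_wait x e) / 2) \<omega> n"
          using x w by (intro AE_tcp_jump_time_exceeds) simp
        then have "AE \<omega> in tcp_noise. f (tcp_path x (e ## \<omega>) t) =
          f (tcp_path ((x + tcp_wait x e) / 2) \<omega> (t - tcp_wait x e))"
          by eventually_elim (use False in \<open>simp add: tcp_path_Stream_after\<close>)
        then show ?thesis
          using False by (simp add: tcp_semigroup_def cong: nn_integral_cong_AE)
      qed (simp add: tcp_path_Stream_before tcp_noise.emeasure_space_1[simplified])
    qed
  qed
  finally show ?thesis
    using nn_integral_tcp_wait[OF x t, of "\<lambda>s. tcp_semigroup f (t - s) ((x + s) / 2)" "f (x + t)"]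
    by simp
qed

text \<open>Surviving until \<open>r\<close> only removes the first jumps before \<open>r\<close>
  from the renewal integral: the integrand is the same for every \<open>r\<close>, and only its
  domain shrinks to [r, t].\<close>

lemma tcp_semigroup_along_flow:
  assumes x: "0 \<le> x" and r: "0 \<le> r" "r \<le> t" and f [measurable]: "f \<in> borel_measurable borel"
  shows "ennreal (exp (- hazard x r)) * tcp_semigroup f (t - r) (x + r) =
    f (x + t) * ennreal (exp (- hazard x t)) +
    (\<integral>\<^sup>+s. ennreal (wait_density x s) * tcp_semigroup f (t - s) ((x + s) / 2) * indicator {r..t} s \<partial>lborel)"
proof -
  let ?E = "ennreal (exp (- hazard x r))"
  have E: "exp (- hazard x r) * exp (- hazard (x + r) s) = exp (- hazard x (r + s))" for s
    by (simp add: hazard_add mult_exp_exp)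
  have W: "?E * ennreal (wait_density (x + r) s) = ennreal (wait_density x (r + s))" for s
    unfolding wait_density_def E[symmetric] by (simp add: mult_ac add.assoc flip: ennreal_mult')
  have "?E * tcp_semigroup f (t - r) (x + r) = ?E * (f (x + t) * ennreal (exp (- hazard (x + r) (t - r)))) +
    ?E * (\<integral>\<^sup>+s. ennreal (wait_density (x + r) s) *
      tcp_semigroup f (t - r - s) ((x + r + s) / 2) * indicator {0..t - r} s \<partial>lborel)"
    using x r by (subst tcp_semigroup_renewal) (simp_all add: distrib_left)
  also have "?E * (f (x + t) * ennreal (exp (- hazard (x + r) (t - r)))) =
    f (x + t) * ennreal (exp (- hazard x t))"
    using E[of "t - r"] by (simp add: mult.left_commute[of ?E] flip: ennreal_mult)
  also have "?E * (\<integral>\<^sup>+s. ennreal (wait_density (x + r) s) *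
      tcp_semigroup f (t - r - s) ((x + r + s) / 2) * indicator {0..t - r} s \<partial>lborel) = (\<integral>\<^sup>+s. ?E * (ennreal (wait_density (x + r) s) *
      tcp_semigroup f (t - r - s) ((x + r + s) / 2) * indicator {0..t - r} s) \<partial>lborel)"
    by (rule nn_integral_cmult[symmetric]) simp
  also have "(\<integral>\<^sup>+s. ?E * (ennreal (wait_density (x + r) s) *
      tcp_semigroup f (t - r - s) ((x + r + s) / 2) * indicator {0..t - r} s) \<partial>lborel) =
    (\<integral>\<^sup>+s. ennreal (wait_density x (r + 1 * s)) *
      tcp_semigroup f (t - (r + 1 * s)) ((x + (r + 1 * s)) / 2) * indicator {r..t} (r + 1 * s) \<partial>lborel)"
    by (intro nn_integral_cong)
      (auto split: split_indicator simp: W[symmetric] mult.assoc add.assoc diff_diff_eq)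
  also have "\<dots> = (\<integral>\<^sup>+s. ennreal (wait_density x s) *
      tcp_semigroup f (t - s) ((x + s) / 2) * indicator {r..t} s \<partial>lborel)"
    by (subst nn_integral_real_affine[where c = 1 and t = r]) simp_all
  finally show ?thesis .
qed

lemma nn_integral_exp_Icc:
  assumes "0 \<le> \<delta>" "0 \<le> r"
  shows "(\<integral>\<^sup>+s. ennreal (\<delta> * exp (- (\<delta> * s))) * indicator {0..r} s \<partial>lborel) = ennreal (1 - exp (- (\<delta> * r)))"
  using assms
  by (subst nn_integral_FTC_Icc[where F = "\<lambda>s. - exp (- (\<delta> * s))"])
    (auto intro!: derivative_eq_intros)

text \<open>The process may be run with the larger jump rate \<open>m + s\<close> if a proposed jump is accepted with
  probability \<open>(y + s) / (m + s)\<close>. The proof is Fubini: a rejected proposal restarts the process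
  on its flow line, where \<open>tcp_semigroup_along_flow\<close> applies.\<close>

lemma tcp_semigroup_thinned:
  assumes y: "0 \<le> y" "y \<le> m" and t: "0 \<le> t" and f [measurable]: "f \<in> borel_measurable borel"
  shows "tcp_semigroup f t y = f (y + t) * ennreal (exp (- hazard m t)) +
    (\<integral>\<^sup>+s. ennreal (exp (- hazard m s)) * (ennreal (y + s) * tcp_semigroup f (t - s) ((y + s) / 2) +
      ennreal (m - y) * tcp_semigroup f (t - s) (y + s)) * indicator {0..t} s \<partial>lborel)"
proof -
  \<comment> \<open>The rate of rejected proposals, \<open>(m + s) - (y + s)\<close>, does not
    depend on \<open>s\<close>, so rejections follow an exponential clock independent of the true
    jumps.\<close>
  define \<delta> where "\<delta> = m - y"
  have \<delta>: "0 \<le> \<delta>" using y by (simp add: \<delta>_def)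
  define u where "u s = ennreal (wait_density y s) * tcp_semigroup f (t - s) ((y + s) / 2)" for s
  have [measurable]: "u \<in> borel_measurable borel"
    unfolding u_def by measurable
  define c where "c = f (y + t) * ennreal (exp (- hazard y t))"
  have E: "exp (- hazard m s) = exp (- (\<delta> * s)) * exp (- hazard y s)" for s
    by (simp add: hazard_def \<delta>_def mult_exp_exp algebra_simps)
  have flow: "ennreal (exp (- hazard y s)) * tcp_semigroup f (t - s) (y + s) =
    c + (\<integral>\<^sup>+r. u r * indicator {s..t} r \<partial>lborel)" if "0 \<le> s" "s \<le> t" for s
    using tcp_semigroup_along_flow[OF y(1) that f] by (simp add: c_def u_def)
  \<comment> \<open>Here \<open>s\<close> is the time of a rejection and \<open>r \<ge> s\<close>
    that of the first true jump after it. Integrating out \<open>s\<close> leaves the probability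
    that the rejection clock rings before \<open>r\<close>.\<close>
  have fub: "(\<integral>\<^sup>+s. ennreal (\<delta> * exp (- (\<delta> * s))) * indicator {0..t} s * (\<integral>\<^sup>+r. u r * indicator {s..t} r \<partial>lborel) \<partial>lborel)
    = (\<integral>\<^sup>+r. u r * indicator {0..t} r * ennreal (1 - exp (- (\<delta> * r))) \<partial>lborel)" (is "?L = ?R")
  proof -
    have "?L = (\<integral>\<^sup>+s. \<integral>\<^sup>+r. ennreal (\<delta> * exp (- (\<delta> * s))) * indicator {0..t} s * (u r * indicator {s..t} r) \<partial>lborel \<partial>lborel)"
      by (intro nn_integral_cong) (simp add: nn_integral_cmult)
    also have "\<dots> = (\<integral>\<^sup>+r. \<integral>\<^sup>+s. ennreal (\<delta> * exp (- (\<delta> * s))) * indicator {0..t} s * (u r * indicator {s..t} r) \<partial>lborel \<partial>lborel)"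
      by (rule lborel_pair.Fubini') (auto simp: indicator_def)
    also have "\<dots> = (\<integral>\<^sup>+r. \<integral>\<^sup>+s. (u r * indicator {0..t} r) * (ennreal (\<delta> * exp (- (\<delta> * s))) * indicator {0..r} s) \<partial>lborel \<partial>lborel)"
      by (intro nn_integral_cong) (auto split: split_indicator simp: mult_ac)
    also have "\<dots> = ?R"
      by (intro nn_integral_cong)
        (auto simp: nn_integral_cmult nn_integral_exp_Icc[OF \<delta>] split: split_indicator)
    finally show ?thesis .
  qed
  have "(\<integral>\<^sup>+s. ennreal (exp (- hazard m s)) * (ennreal (y + s) * tcp_semigroup f (t - s) ((y + s) / 2) +
      ennreal (m - y) * tcp_semigroup f (t - s) (y + s)) * indicator {0..t} s \<partial>lborel) =
    (\<integral>\<^sup>+s. u s * indicator {0..t} s * ennreal (exp (- (\<delta> * s))) +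
      (c * (ennreal (\<delta> * exp (- (\<delta> * s))) * indicator {0..t} s) +
       ennreal (\<delta> * exp (- (\<delta> * s))) * indicator {0..t} s * (\<integral>\<^sup>+r. u r * indicator {s..t} r \<partial>lborel)) \<partial>lborel)"
  proof (intro nn_integral_cong)
    fix s
    let ?V = "tcp_semigroup f (t - s) ((y + s) / 2)" and ?W = "tcp_semigroup f (t - s) (y + s)"
    show "ennreal (exp (- hazard m s)) * (ennreal (y + s) * ?V + ennreal (m - y) * ?W) * indicator {0..t} s =
      u s * indicator {0..t} s * ennreal (exp (- (\<delta> * s))) +
      (c * (ennreal (\<delta> * exp (- (\<delta> * s))) * indicator {0..t} s) +
       ennreal (\<delta> * exp (- (\<delta> * s))) * indicator {0..t} s * (\<integral>\<^sup>+r. u r * indicator {s..t} r \<partial>lborel))"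
    proof (cases "s \<in> {0..t}")
      case True
      then have s: "0 \<le> s" "s \<le> t" by auto
      have "ennreal (exp (- hazard m s)) * (ennreal (y + s) * ?V + ennreal (m - y) * ?W) =
        ennreal (exp (- (\<delta> * s))) * (ennreal (exp (- hazard y s)) * ennreal (y + s) * ?V) +
        ennreal \<delta> * ennreal (exp (- (\<delta> * s))) * (ennreal (exp (- hazard y s)) * ?W)"
        unfolding E \<delta>_def[symmetric] by (simp add: ennreal_mult algebra_simps)
      also have "ennreal (exp (- hazard y s)) * ennreal (y + s) * ?V = u s"
        using y s by (simp add: u_def wait_density_def ennreal_mult mult_ac)
      finally show ?thesis
        using True \<delta> unfolding flow[OF s] by (simp add: ennreal_mult algebra_simps)
    qed simp
  qed
  also have "\<dots> = (\<integral>\<^sup>+s. u s * indicator {0..t} s * ennreal (exp (- (\<delta> * s))) \<partial>lborel) +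
      (c * ennreal (1 - exp (- (\<delta> * t))) +
       (\<integral>\<^sup>+s. u s * indicator {0..t} s * ennreal (1 - exp (- (\<delta> * s))) \<partial>lborel))"
  proof -
    have [measurable]: "(\<lambda>s. \<integral>\<^sup>+r. u r * indicator {s..t} r \<partial>lborel) \<in> borel_measurable borel"
      by (rule lborel.borel_measurable_nn_integral) (simp add: indicator_def split_beta')
    show ?thesis
      by (subst nn_integral_add, simp, simp, subst nn_integral_add, simp, simp)
        (simp add: fub nn_integral_cmult nn_integral_exp_Icc \<delta> t)
  qed
  finally have "f (y + t) * ennreal (exp (- hazard m t)) +
    (\<integral>\<^sup>+s. ennreal (exp (- hazard m s)) * (ennreal (y + s) * tcp_semigroup f (t - s) ((y + s) / 2) +
      ennreal (m - y) * tcp_semigroup f (t - s) (y + s)) * indicator {0..t} s \<partial>lborel) =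
    c * (ennreal (exp (- (\<delta> * t))) + ennreal (1 - exp (- (\<delta> * t)))) +
    ((\<integral>\<^sup>+s. u s * indicator {0..t} s * ennreal (exp (- (\<delta> * s))) \<partial>lborel) +
     (\<integral>\<^sup>+s. u s * indicator {0..t} s * ennreal (1 - exp (- (\<delta> * s))) \<partial>lborel))"
    unfolding E c_def by (simp add: ennreal_mult algebra_simps)
  also have "\<dots> = c + (\<integral>\<^sup>+s. u s * indicator {0..t} s *
      (ennreal (exp (- (\<delta> * s))) + ennreal (1 - exp (- (\<delta> * s)))) \<partial>lborel)"
    using \<delta> t by (subst nn_integral_add[symmetric]) (auto simp: distrib_left simp flip: ennreal_plus)
  also have "\<dots> = c + (\<integral>\<^sup>+s. u s * indicator {0..t} s \<partial>lborel)"
    using \<delta> by (intro arg_cong2[where f = "(+)"] nn_integral_cong)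
      (auto split: split_indicator simp flip: ennreal_plus)
  also have "\<dots> = tcp_semigroup f t y"
    using tcp_semigroup_renewal[OF y(1) t f] by (simp add: c_def u_def)
  finally show ?thesis by simp
qed

section \<open>Comparison with supersolutions\<close>

lemma nn_integral_power_fact:
  fixes B :: real
  assumes "0 \<le> B" "0 \<le> C" "0 \<le> t"
  shows "(\<integral>\<^sup>+s. ennreal (B * (C * (B * (t - s)) ^ n / fact n)) * indicator {0..t} s \<partial>lborel) \<le>
    ennreal (C * (B * t) ^ Suc n / fact (Suc n))"
proof -
  have "((\<lambda>s. - (C * (B * (t - s)) ^ Suc n / fact (Suc n))) has_real_derivative
      B * (C * (B * (t - s)) ^ n / fact n)) (at s)" for s
    by (rule derivative_eq_intros refl | simp)+
  then show ?thesis
    using assms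
    by (subst nn_integral_FTC_Icc[where F = "\<lambda>s. - (C * (B * (t - s)) ^ Suc n / fact (Suc n))"]) auto
qed

text \<open>\<open>D\<close> is a region on which the jump rate \<open>q\<close> is at most \<open>B\<close>, so that \<open>n\<close> jumps occur before
  time \<open>t\<close> with probability at most \<open>(B t)^n / n!\<close>; \<open>J z s v\<close> is the position after a jump at time
  \<open>s\<close>, randomised by \<open>v\<close>.\<close>

lemma supersolution_bound:
  fixes u :: "nat \<Rightarrow> real \<Rightarrow> 's \<Rightarrow> ennreal" and w g :: "real \<Rightarrow> 's \<Rightarrow> ennreal"
    and D :: "real \<Rightarrow> 's set" and U :: "'v measure"
  assumes U: "prob_space U" and B: "0 \<le> B" and C: "0 \<le> C"
    and D: "\<And>t z s v. z \<in> D t \<Longrightarrow> 0 \<le> s \<Longrightarrow> s \<le> t \<Longrightarrow> v \<in> space U \<Longrightarrow> J z s v \<in> D (t - s)"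
    and time: "\<And>t z. z \<in> D t \<Longrightarrow> 0 \<le> t"
    and rate: "\<And>t z s. z \<in> D t \<Longrightarrow> 0 \<le> s \<Longrightarrow> s \<le> t \<Longrightarrow> q z s \<le> B"
    and q [measurable]: "\<And>z. q z \<in> borel_measurable borel"
    and w: "\<And>t z. z \<in> D t \<Longrightarrow> (\<lambda>(s, v). w (t - s) (J z s v)) \<in> borel_measurable (borel \<Otimes>\<^sub>M U)"
    and sub: "\<And>n t z. z \<in> D t \<Longrightarrow> u (Suc n) t z \<le> g t z +
      (\<integral>\<^sup>+s. ennreal (q z s) * (\<integral>\<^sup>+v. u n (t - s) (J z s v) \<partial>U) * indicator {0..t} s \<partial>lborel)"
    and super: "\<And>t z. z \<in> D t \<Longrightarrow> g t z +
      (\<integral>\<^sup>+s. ennreal (q z s) * (\<integral>\<^sup>+v. w (t - s) (J z s v) \<partial>U) * indicator {0..t} s \<partial>lborel) \<le> w t z"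
    and bound: "\<And>t z. z \<in> D t \<Longrightarrow> u 0 t z \<le> ennreal C"
  shows "z \<in> D t \<Longrightarrow> u n t z \<le> w t z + ennreal (C * (B * t) ^ n / fact n)"
proof (induction n arbitrary: t z)
  case 0
  then show ?case using bound[OF 0] by (simp add: add_increasing)
next
  case (Suc n)
  interpret U: prob_space U by fact
  note z = Suc.prems
  have t: "0 \<le> t" using time[OF z] .
  have [measurable]: "(\<lambda>(s, v). w (t - s) (J z s v)) \<in> borel_measurable (borel \<Otimes>\<^sub>M U)"
    using w[OF z] .
  define W where "W s = (\<integral>\<^sup>+v. w (t - s) (J z s v) \<partial>U)" for s
  have [measurable]: "W \<in> borel_measurable borel"
    unfolding W_def by measurable
  define \<epsilon> where "\<epsilon> s = C * (B * (t - s)) ^ n / fact n" for s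
  have [measurable]: "\<epsilon> \<in> borel_measurable borel"
    unfolding \<epsilon>_def by measurable
  have "u (Suc n) t z \<le> g t z +
      (\<integral>\<^sup>+s. ennreal (q z s) * (\<integral>\<^sup>+v. u n (t - s) (J z s v) \<partial>U) * indicator {0..t} s \<partial>lborel)"
    by (rule sub[OF z])
  also have "\<dots> \<le> g t z +
      (\<integral>\<^sup>+s. ennreal (q z s) * W s * indicator {0..t} s + ennreal (B * \<epsilon> s) * indicator {0..t} s \<partial>lborel)"
  proof (intro add_left_mono nn_integral_mono)
    fix s
    show "ennreal (q z s) * (\<integral>\<^sup>+v. u n (t - s) (J z s v) \<partial>U) * indicator {0..t} s \<le>
      ennreal (q z s) * W s * indicator {0..t} s + ennreal (B * \<epsilon> s) * indicator {0..t} s"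
    proof (cases "s \<in> {0..t}")
      case True
      have [measurable]: "(\<lambda>v. w (t - s) (J z s v)) \<in> borel_measurable U"
        using measurable_compose[OF measurable_Pair1' w[OF z], of s] by simp
      have "(\<integral>\<^sup>+v. u n (t - s) (J z s v) \<partial>U) \<le> (\<integral>\<^sup>+v. w (t - s) (J z s v) + ennreal (\<epsilon> s) \<partial>U)"
        using True D[OF z] by (intro nn_integral_mono) (auto simp: \<epsilon>_def intro!: Suc.IH)
      also have "\<dots> = W s + ennreal (\<epsilon> s)"
        by (subst nn_integral_add) (auto simp: W_def U.emeasure_space_1)
      finally have "ennreal (q z s) * (\<integral>\<^sup>+v. u n (t - s) (J z s v) \<partial>U) \<le>
        ennreal (q z s) * (W s + ennreal (\<epsilon> s))"
        by (rule mult_left_mono) simp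
      also have "\<dots> \<le> ennreal (q z s) * W s + ennreal B * ennreal (\<epsilon> s)"
        using True rate[OF z, of s] by (auto simp: distrib_left intro!: add_left_mono mult_right_mono ennreal_leI)
      finally show ?thesis using True B by (simp add: ennreal_mult')
    qed simp
  qed
  also have "\<dots> = g t z + (\<integral>\<^sup>+s. ennreal (q z s) * W s * indicator {0..t} s \<partial>lborel) +
      (\<integral>\<^sup>+s. ennreal (B * \<epsilon> s) * indicator {0..t} s \<partial>lborel)"
    by (subst nn_integral_add) (auto simp: add.assoc)
  also have "\<dots> \<le> w t z + ennreal (C * (B * t) ^ Suc n / fact (Suc n))"
    unfolding \<epsilon>_def using nn_integral_power_fact[OF B C t, of n]
    by (intro add_mono super[OF z, folded W_def])
  finally show ?case .
qed

lemma power_fact_less: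
  fixes x C :: real
  assumes "0 < e"
  shows "\<exists>n. C * x ^ n / fact n < e"
proof -
  have "(\<lambda>n. x ^ n / fact n) \<longlonglongrightarrow> 0"
    using summable_LIMSEQ_zero[OF summable_exp[of x]] by (simp add: field_simps)
  then have "(\<lambda>n. C * (x ^ n / fact n)) \<longlonglongrightarrow> C * 0"
    by (intro tendsto_intros)
  then have "\<forall>\<^sub>F n in sequentially. C * (x ^ n / fact n) < e"
    using assms by (intro order_tendstoD) simp_all
  then show ?thesis by (auto dest: eventually_happens)
qed

text \<open>Applied in both directions it gives uniqueness for the renewal equation. Local
  boundedness of \<open>u\<close> suffices, since \<open>x + t\<close> never increases: a jump at
  \<open>s\<close> leads from \<open>(x, t)\<close> to \<open>((x + s) / 2, t - s)\<close>.\<close>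

lemma renewal_comparison:
  fixes u w :: "real \<Rightarrow> real \<Rightarrow> ennreal"
  assumes w [measurable]: "(\<lambda>(t, x). w t x) \<in> borel_measurable (borel \<Otimes>\<^sub>M borel)"
    and sub: "\<And>t x. 0 \<le> t \<Longrightarrow> 0 \<le> x \<Longrightarrow> u t x \<le> f (x + t) * ennreal (exp (- hazard x t)) +
      (\<integral>\<^sup>+s. ennreal (wait_density x s) * u (t - s) ((x + s) / 2) * indicator {0..t} s \<partial>lborel)"
    and super: "\<And>t x. 0 \<le> t \<Longrightarrow> 0 \<le> x \<Longrightarrow> f (x + t) * ennreal (exp (- hazard x t)) +
      (\<integral>\<^sup>+s. ennreal (wait_density x s) * w (t - s) ((x + s) / 2) * indicator {0..t} s \<partial>lborel) \<le> w t x"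
    and bound: "\<And>B. \<exists>C. \<forall>t x. 0 \<le> t \<longrightarrow> 0 \<le> x \<longrightarrow> x + t \<le> B \<longrightarrow> u t x \<le> ennreal C"
    and t: "0 \<le> t" and x: "0 \<le> x"
  shows "u t x \<le> w t x"
proof -
  define B where "B = x + t"
  obtain C0 where C0: "\<And>t x. 0 \<le> t \<Longrightarrow> 0 \<le> x \<Longrightarrow> x + t \<le> B \<Longrightarrow> u t x \<le> ennreal C0"
    using bound[of B] by blast
  define C where "C = max 0 C0"
  have C: "u t x \<le> ennreal C" if "0 \<le> t" "0 \<le> x" "x + t \<le> B" for t x
    by (rule order_trans[OF C0[OF that]]) (simp add: C_def ennreal_leI)
  define D where "D t = {x. 0 \<le> t \<and> 0 \<le> x \<and> x + t \<le> B}" for t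
  \<comment> \<open>A one-point space: the position after a jump at time \<open>s\<close> involves
    no further randomness here.\<close>
  let ?U = "return (count_space UNIV) ()"
  have U: "prob_space ?U" by (rule prob_space_return) simp
  then have [simp]: "emeasure ?U UNIV = 1"
    using prob_space.emeasure_space_1[OF U] by simp
  have *: "u t x \<le> w t x + ennreal (C * (B * t) ^ n / fact n)" for n
  proof (rule supersolution_bound[where u = "\<lambda>_. u" and D = D and U = ?U and q = wait_density
        and J = "\<lambda>x s _. (x + s) / 2" and g = "\<lambda>t x. f (x + t) * ennreal (exp (- hazard x t))"])
    show "x \<in> D t" using x t by (simp add: D_def B_def)
    show "(y + s) / 2 \<in> D (r - s)" if "y \<in> D r" "0 \<le> s" "s \<le> r" for y r s
      using that by (auto simp: D_def field_simps)
    show "wait_density y s \<le> B" if "y \<in> D r" "0 \<le> s" "s \<le> r" for y r s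
      using wait_density_le[of y s] that by (auto simp: D_def)
    show "(\<lambda>(s, v). w (r - s) ((y + s) / 2)) \<in> borel_measurable (borel \<Otimes>\<^sub>M ?U)" for r y
      by measurable
    show "0 \<le> C" by (simp add: C_def)
  qed (use U x t sub super C in \<open>auto simp: D_def B_def\<close>)
  show ?thesis
  proof (rule ennreal_le_epsilon)
    fix e :: real assume "0 < e"
    then obtain n where "C * (B * t) ^ n / fact n < e" using power_fact_less by blast
    then show "u t x \<le> w t x + ennreal e"
      by (intro order_trans[OF *[of n]] add_left_mono ennreal_leI) simp
  qed
qed

lemma tcp_semigroup_bounded:
  assumes "\<And>y. 0 \<le> y \<Longrightarrow> y \<le> x + t \<Longrightarrow> f y \<le> C" "0 \<le> t" "0 \<le> x"
  shows "tcp_semigroup f t x \<le> C"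
proof -
  have "tcp_semigroup f t x \<le> (\<integral>\<^sup>+\<omega>. C \<partial>tcp_noise)"
    unfolding tcp_semigroup_def
  proof (rule nn_integral_mono_AE)
    show "AE \<omega> in tcp_noise. f (tcp_path x \<omega> t) \<le> C"
      using AE_tcp_path_bounds[OF assms(3,2)] by eventually_elim (auto intro: assms(1))
  qed
  then show ?thesis by (simp add: tcp_noise.emeasure_space_1[simplified])
qed

lemma tcp_semigroup_le_supersolution:
  assumes f [measurable]: "f \<in> borel_measurable borel"
    and bound: "\<And>B. \<exists>C. \<forall>y. 0 \<le> y \<longrightarrow> y \<le> B \<longrightarrow> f y \<le> ennreal C"
    and w: "(\<lambda>(t, x). w t x) \<in> borel_measurable (borel \<Otimes>\<^sub>M borel)"
    and super: "\<And>t x. 0 \<le> t \<Longrightarrow> 0 \<le> x \<Longrightarrow> f (x + t) * ennreal (exp (- hazard x t)) +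
      (\<integral>\<^sup>+s. ennreal (wait_density x s) * w (t - s) ((x + s) / 2) * indicator {0..t} s \<partial>lborel) \<le> w t x"
    and "0 \<le> t" "0 \<le> x"
  shows "tcp_semigroup f t x \<le> w t x"
proof (rule renewal_comparison[OF w _ super])
  show "tcp_semigroup f t x \<le> f (x + t) * ennreal (exp (- hazard x t)) +
      (\<integral>\<^sup>+s. ennreal (wait_density x s) * tcp_semigroup f (t - s) ((x + s) / 2) * indicator {0..t} s \<partial>lborel)"
    if "0 \<le> t" "0 \<le> x" for t x
    using tcp_semigroup_renewal[OF that(2,1) f] by simp
  show "\<exists>C. \<forall>t x. 0 \<le> t \<longrightarrow> 0 \<le> x \<longrightarrow> x + t \<le> B \<longrightarrow> tcp_semigroup f t x \<le> ennreal C" for B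
    using bound[of B] by (meson tcp_semigroup_bounded order_trans)
qed (use assms in auto)

text \<open>Both sides, as functions of \<open>s\<close>, solve the renewal equation with terminal
  payoff \<open>tcp_semigroup f t\<close>, so two comparisons give equality. The bound by 1 covers
  indicators, which determine the laws.\<close>

lemma tcp_semigroup_add:
  assumes f [measurable]: "f \<in> borel_measurable borel" and f1: "\<And>y. f y \<le> 1"
    and t: "0 \<le> t" and s: "0 \<le> s" and x: "0 \<le> x"
  shows "tcp_semigroup f (s + t) x = tcp_semigroup (tcp_semigroup f t) s x"
proof -
  let ?g = "tcp_semigroup f t"
  have [measurable]: "?g \<in> borel_measurable borel"
    by measurable
  have le1: "tcp_semigroup h r y \<le> 1" if "0 \<le> r" "0 \<le> y" "\<And>y. 0 \<le> y \<Longrightarrow> h y \<le> 1" for h r y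
    using that by (intro tcp_semigroup_bounded) auto
  have eq: "tcp_semigroup f (r + t) y = ?g (y + r) * ennreal (exp (- hazard y r)) +
      (\<integral>\<^sup>+s. ennreal (wait_density y s) * tcp_semigroup f ((r - s) + t) ((y + s) / 2) * indicator {0..r} s \<partial>lborel)"
    if r: "0 \<le> r" and y: "0 \<le> y" for r y
  proof -
    let ?h = "\<lambda>s. ennreal (wait_density y s) * tcp_semigroup f (r + t - s) ((y + s) / 2)"
    let ?c = "f (y + (r + t)) * ennreal (exp (- hazard y (r + t)))"
    have "tcp_semigroup f (r + t) y = ?c + (\<integral>\<^sup>+s. ?h s * indicator {0..r + t} s \<partial>lborel)"
      using r y t by (intro tcp_semigroup_renewal) auto
    \<comment> \<open>Split at \<open>r\<close>: together with \<open>?c\<close>, the first jumps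
      after \<open>r\<close> form the value at the flow position \<open>y + r\<close>, by
      \<open>tcp_semigroup_along_flow\<close>.\<close>
    also have "(\<integral>\<^sup>+s. ?h s * indicator {0..r + t} s \<partial>lborel) =
      (\<integral>\<^sup>+s. ?h s * indicator {r..r + t} s + ?h s * indicator {0..r} s \<partial>lborel)"
      using AE_lborel_singleton[of r] r t
      by (intro nn_integral_cong_AE) (auto split: split_indicator)
    also have "\<dots> = (\<integral>\<^sup>+s. ?h s * indicator {r..r + t} s \<partial>lborel) + (\<integral>\<^sup>+s. ?h s * indicator {0..r} s \<partial>lborel)"
      by (subst nn_integral_add) auto
    also have "?c + \<dots> = ennreal (exp (- hazard y r)) * tcp_semigroup f (r + t - r) (y + r) +
      (\<integral>\<^sup>+s. ?h s * indicator {0..r} s \<partial>lborel)"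
      using r t y by (subst tcp_semigroup_along_flow) (auto simp: add.assoc)
    finally show ?thesis
      by (simp add: mult.commute algebra_simps)
  qed
  show ?thesis
  proof (rule antisym)
    show "tcp_semigroup f (s + t) x \<le> tcp_semigroup ?g s x"
    proof (rule renewal_comparison[where f = ?g and u = "\<lambda>s. tcp_semigroup f (s + t)" and w = "tcp_semigroup ?g"])
      show "\<exists>C. \<forall>r x. 0 \<le> r \<longrightarrow> 0 \<le> x \<longrightarrow> x + r \<le> B \<longrightarrow> tcp_semigroup f (r + t) x \<le> ennreal C" for B
        using f1 t le1 by (intro exI[of _ 1]) auto
    qed (use s x eq tcp_semigroup_renewal[of _ _ ?g] in auto)
    show "tcp_semigroup ?g s x \<le> tcp_semigroup f (s + t) x"
    proof (rule tcp_semigroup_le_supersolution[where w = "\<lambda>s. tcp_semigroup f (s + t)"])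
      show "\<exists>C. \<forall>y. 0 \<le> y \<longrightarrow> y \<le> B \<longrightarrow> ?g y \<le> ennreal C" for B
        using f1 t le1 by (intro exI[of _ 1]) auto
    qed (use s x eq in auto)
  qed
qed

section \<open>Moments\<close>

text \<open>Finitely many exceptional points are allowed because the weight in the contraction estimate
  has a kink.\<close>

lemma nn_integral_le_decrement:
  fixes \<phi> G :: "real \<Rightarrow> real"
  assumes t: "0 \<le> t" and S: "finite S" and cont: "continuous_on {0..t} \<phi>"
    and deriv: "\<And>s. 0 < s \<Longrightarrow> s < t \<Longrightarrow> s \<notin> S \<Longrightarrow> (\<phi> has_real_derivative \<phi>' s) (at s)"
    and G: "\<And>s. 0 < s \<Longrightarrow> s < t \<Longrightarrow> s \<notin> S \<Longrightarrow> 0 \<le> G s \<and> \<phi>' s \<le> - G s"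
    and nonneg: "0 \<le> \<phi> t"
  shows "ennreal (\<phi> t) + (\<integral>\<^sup>+s. ennreal (G s) * indicator {0..t} s \<partial>lborel) \<le> ennreal (\<phi> 0)"
proof -
  \<comment> \<open>The value 0 at the exceptional points makes \<open>k\<close> nonnegative
    everywhere, as needed to turn its gauge integral into a Lebesgue integral.\<close>
  define k where "k s = (if 0 < s \<and> s < t \<and> s \<notin> S then - \<phi>' s else 0)" for s
  have k0: "0 \<le> k s" for s using G[of s] by (auto simp: k_def)
  have "(k has_integral (- \<phi> t - - \<phi> 0)) {0..t}"
  proof (rule fundamental_theorem_of_calculus_interior_strong[OF S t])
    show "((\<lambda>s. - \<phi> s) has_vector_derivative k s) (at s)" if "s \<in> {0<..<t} - S" for s
      using that deriv[of s]
      by (auto simp: k_def simp flip: has_real_derivative_iff_has_vector_derivative intro!: DERIV_minus)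
  qed (use cont in \<open>auto intro!: continuous_intros\<close>)
  then have k: "(k has_integral (\<phi> 0 - \<phi> t)) {0..t}" by simp
  have "(\<integral>\<^sup>+s. ennreal (G s) * indicator {0..t} s \<partial>lborel) \<le> (\<integral>\<^sup>+s. ennreal (k s) * indicator {0..t} s \<partial>lborel)"
  proof (rule nn_integral_mono_AE)
    have "S \<union> {0, t} \<in> null_sets lborel"
      using S by (intro finite_imp_null_set_lborel) auto
    then have "AE s in lborel. s \<notin> S \<union> {0, t}" by (rule AE_not_in)
    then show "AE s in lborel. ennreal (G s) * indicator {0..t} s \<le> ennreal (k s) * indicator {0..t} s"
    proof eventually_elim
      case (elim s)
      then show ?case using G[of s] by (auto simp: k_def split: split_indicator intro!: ennreal_leI)
    qed
  qed
  also have "\<dots> = ennreal (\<phi> 0 - \<phi> t)"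
    using k k0 by (intro nn_integral_has_integral_lebesgue')
  finally have "ennreal (\<phi> t) + (\<integral>\<^sup>+s. ennreal (G s) * indicator {0..t} s \<partial>lborel) \<le>
    ennreal (\<phi> t) + ennreal (\<phi> 0 - \<phi> t)"
    by (rule add_left_mono)
  also have "\<dots> = ennreal (\<phi> 0)"
    using nonneg has_integral_nonneg[OF k] k0 by (subst ennreal_plus[symmetric]) auto
  finally show ?thesis .
qed

text \<open>\<open>Z\<close> is the solution at time \<tau> of \<open>z' = - c z^2\<close> started
  from \<open>X\<close>. The left side bounds the growth of \<open>Z^(n+1)\<close> between jumps,
  less a constant; the right side is the mean loss through jumps at rate \<open>X\<close>. The
  choice of \<open>c\<close> makes the growth term \<open>(n + 1) * c * Z^(n+2)\<close> equal to a
  quarter of \<open>Z^(n+2)\<close>, while the loss is at least half of it.\<close>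

lemma moment_inequality:
  fixes c \<tau> X Z :: real and n :: nat
  assumes c: "c = 1 / (4 * real (Suc n))" and \<tau>: "0 \<le> \<tau>" and X: "0 \<le> X"
  defines "Z \<equiv> X / (1 + c * \<tau> * X)"
  shows "Suc n * Z ^ n * (1 + c * Z\<^sup>2) - (4 * real (Suc n)) ^ Suc n \<le>
    X * (Z ^ Suc n - ((X / 2) / (1 + c * \<tau> * (X / 2))) ^ Suc n)"
proof -
  define a where "a = c * \<tau> * X"
  have a: "0 \<le> a" using assms by (simp add: a_def)
  define Y where "Y = (X / 2) / (1 + c * \<tau> * (X / 2))"
  have Y: "Y = X / (2 + a)" using a by (simp add: Y_def a_def divide_simps)
  have Z: "Z = X / (1 + a)" by (simp add: Z_def a_def)
  have Z0: "0 \<le> Z" and Y0: "0 \<le> Y" and YZ: "Y \<le> Z"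
    using a X by (auto simp: Y Z intro!: divide_left_mono mult_pos_pos)
  \<comment> \<open>With \<open>a = c * \<tau> * X\<close> the difference \<open>Z - Y\<close> is
    \<open>X / ((1 + a) (2 + a))\<close>, so \<open>(Z - Y) * X = Z * X / (2 + a)\<close>, and
    \<open>X / (2 + a)\<close> is at least \<open>X / (2 + 2 a) = Z / 2\<close>.\<close>
  have "Z / 2 * Z \<le> (Z - Y) * X"
  proof -
    have "Z / 2 \<le> X / (2 + a)"
      using a X by (simp add: Z) (intro divide_left_mono mult_pos_pos; simp)
    then have "Z / 2 * Z \<le> X / (2 + a) * Z"
      using Z0 by (rule mult_right_mono)
    also have "\<dots> = (Z - Y) * X"
      using a by (simp add: Y Z divide_simps) (simp add: algebra_simps)
    finally show ?thesis .
  qed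
  then have "Z ^ n * (Z / 2 * Z) \<le> Z ^ n * ((Z - Y) * X)"
    using Z0 by (intro mult_left_mono) auto
  also have "\<dots> \<le> X * (Z ^ Suc n - Y ^ Suc n)"
  proof -
    have "Y ^ n * Y \<le> Z ^ n * Y"
      using YZ Y0 by (intro mult_right_mono power_mono)
    then have "Z ^ n * (Z - Y) \<le> Z ^ Suc n - Y ^ Suc n"
      by (simp add: algebra_simps)
    then show ?thesis using X by (metis mult.assoc mult.commute mult_left_mono)
  qed
  also have "Suc n * Z ^ n * (1 + c * Z\<^sup>2) - (4 * real (Suc n)) ^ Suc n \<le> Z ^ n * (Z / 2 * Z)"
  \<comment> \<open>Above the threshold the remaining quarter of \<open>Z^(n+2)\<close> absorbs
    \<open>(n + 1) * Z^n\<close>; below it that term is bounded by the subtracted constant.\<close>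
  proof (cases "4 * real (Suc n) \<le> Z")
    case True
    have "4 * real (Suc n) * 1 \<le> Z * Z"
      using True by (intro mult_mono) auto
    then have "Z ^ n * (real (Suc n) + Z\<^sup>2 / 4) \<le> Z ^ n * (Z / 2 * Z)"
      using Z0 by (intro mult_left_mono) (auto simp: power2_eq_square)
    moreover have "Suc n * Z ^ n * (1 + c * Z\<^sup>2) = Z ^ n * (real (Suc n) + Z\<^sup>2 / 4)"
      unfolding c by (simp add: field_simps)
    ultimately show ?thesis by (smt (verit) zero_le_power of_nat_0_le_iff)
  next
    case False
    have "real (Suc n) * Z ^ n \<le> (4 * real (Suc n)) ^ Suc n"
      unfolding power_Suc using False Z0 by (intro mult_mono power_mono) auto
    moreover have "Suc n * Z ^ n * (1 + c * Z\<^sup>2) = real (Suc n) * Z ^ n + Z ^ n * (Z / 4 * Z)"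
      unfolding c by (simp add: field_simps power2_eq_square)
    moreover have "Z ^ n * (Z / 4 * Z) \<le> Z ^ n * (Z / 2 * Z)"
      using Z0 by (intro mult_left_mono) auto
    ultimately show ?thesis by linarith
  qed
  finally show ?thesis by (simp add: Y_def)
qed

text \<open>The supersolution \<open>(x / (1 + c t x))^(n + 1) + K t\<close> comes from the solution of
  \<open>z' = - c z^2\<close>, which comes down from infinity; the bound is therefore uniform in \<open>x\<close>.\<close>

lemma tcp_moment_bound:
  assumes t: "0 < t" and x: "0 \<le> x"
  shows "tcp_semigroup (\<lambda>y. ennreal (y ^ Suc n)) t x \<le>
    ennreal ((4 * real (Suc n) / t) ^ Suc n + (4 * real (Suc n)) ^ Suc n * t)"
proof -
  define c where "c = 1 / (4 * real (Suc n))"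
  define K where "K = (4 * real (Suc n)) ^ Suc n"
  have c: "0 < c" by (simp add: c_def)
  have K: "0 \<le> K" by (simp add: K_def)
  define w where "w t x = (x / (1 + c * t * x)) ^ Suc n + K * t" for t x
  have [measurable]: "(\<lambda>(t, x). w t x) \<in> borel_measurable (borel \<Otimes>\<^sub>M borel)"
    unfolding w_def by measurable
  have super: "ennreal ((x + t) ^ Suc n) * ennreal (exp (- hazard x t)) + (\<integral>\<^sup>+s. ennreal (wait_density x s) *
      ennreal (w (t - s) ((x + s) / 2)) * indicator {0..t} s \<partial>lborel) \<le> ennreal (w t x)"
    if t: "0 \<le> t" and x: "0 \<le> x" for t x
  proof -
    \<comment> \<open>\<open>\<phi> s\<close> is the candidate carried along the flow up to
      \<open>s\<close>, times the probability of no jump before \<open>s\<close>; \<open>G s\<close>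
      is what a first jump at \<open>s\<close> contributes. Integrating
      \<open>\<phi>' \<le> - G\<close> over [0, t] is the supersolution inequality.\<close>
    define \<phi> where "\<phi> s = exp (- hazard x s) * w (t - s) (x + s)" for s
    define G where "G s = wait_density x s * w (t - s) ((x + s) / 2)" for s
    define Z where "Z s = (x + s) / (1 + c * (t - s) * (x + s))" for s
    have pos: "0 < 1 + c * (t - s) * (x + s)" if "0 \<le> s" "s \<le> t" for s
      using that x c by (simp add: add_pos_nonneg)
    \<comment> \<open>The term with the squared denominator comes from the motion of the position,
      the term \<open>c * (Z s)^2\<close> from the decreasing remaining time
      \<open>t - s\<close>.\<close>
    have dZ: "(Z has_real_derivative (1 / (1 + c * (t - s) * (x + s))\<^sup>2 + c * (Z s)\<^sup>2)) (at s)"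
      if "0 \<le> s" "s \<le> t" for s
    proof -
      define D where "D s = 1 + c * (t - s) * (x + s)" for s
      have D: "D s \<noteq> 0" using pos[OF that] by (simp add: D_def)
      have dD: "(D has_real_derivative c * (t - s) - c * (x + s)) (at s)"
        unfolding D_def by (auto intro!: derivative_eq_intros simp: algebra_simps)
      have "((\<lambda>s. (x + s) / D s) has_real_derivative
        (1 * D s - (x + s) * (c * (t - s) - c * (x + s))) / (D s * D s)) (at s)"
        by (intro DERIV_divide[OF _ dD D]) (auto intro!: derivative_eq_intros)
      also have "1 * D s - (x + s) * (c * (t - s) - c * (x + s)) = 1 + c * (x + s)\<^sup>2"
        by (simp add: D_def power2_eq_square algebra_simps)
      also have "(1 + c * (x + s)\<^sup>2) / (D s * D s) = 1 / (D s)\<^sup>2 + c * ((x + s) / D s)\<^sup>2"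
        by (subst add_divide_distrib) (simp add: power_divide power2_eq_square)
      finally show ?thesis by (simp add: D_def Z_def[abs_def])
    qed
    define \<phi>' where "\<phi>' s = exp (- hazard x s) * ((Suc n * Z s ^ n *
      (1 / (1 + c * (t - s) * (x + s))\<^sup>2 + c * (Z s)\<^sup>2) - K) - (x + s) * w (t - s) (x + s))" for s
    have d\<phi>: "(\<phi> has_real_derivative \<phi>' s) (at s)" if s: "0 \<le> s" "s \<le> t" for s
    proof -
      have dE: "((\<lambda>s. exp (- hazard x s)) has_real_derivative - wait_density x s) (at s)"
        using DERIV_minus[OF has_derivative_exp_hazard[of x s]] by simp
      have w_eq: "w (t - s) (x + s) = Z s ^ Suc n + K * (t - s)" for s
        by (simp add: w_def Z_def)
      have "((\<lambda>s. w (t - s) (x + s)) has_real_derivative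
        (Suc n * Z s ^ n * (1 / (1 + c * (t - s) * (x + s))\<^sup>2 + c * (Z s)\<^sup>2) - K)) (at s)"
        unfolding w_eq by (rule derivative_eq_intros dZ s refl | simp)+
      from DERIV_mult[OF dE this] show ?thesis
        unfolding \<phi>_def \<phi>'_def wait_density_def by (simp add: algebra_simps)
    qed
    have w0: "0 \<le> w (t - s) y" if "s \<le> t" "0 \<le> y" for s y
      using that c K by (auto simp: w_def intro!: add_nonneg_nonneg)
    have "ennreal (\<phi> t) + (\<integral>\<^sup>+s. ennreal (G s) * indicator {0..t} s \<partial>lborel) \<le> ennreal (\<phi> 0)"
    proof (rule nn_integral_le_decrement[OF t, of "{}" \<phi> \<phi>'])
      show "continuous_on {0..t} \<phi>"
        using d\<phi> by (intro continuous_at_imp_continuous_on) (auto intro!: DERIV_isCont)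
      show "0 \<le> \<phi> t" using w0[of t "x + t"] x t by (simp add: \<phi>_def)
      fix s assume s: "0 < s" "s < t"
      show "(\<phi> has_real_derivative \<phi>' s) (at s)" using s by (intro d\<phi>) auto
      have "1 \<le> 1 + c * (t - s) * (x + s)" using s x c by simp
      then have "1 / (1 + c * (t - s) * (x + s))\<^sup>2 \<le> 1" by (simp add: divide_simps)
      then have "Suc n * Z s ^ n * (1 / (1 + c * (t - s) * (x + s))\<^sup>2 + c * (Z s)\<^sup>2) - K \<le>
        Suc n * Z s ^ n * (1 + c * (Z s)\<^sup>2) - K"
        using s x pos[of s] by (intro diff_right_mono mult_left_mono add_right_mono) (auto simp: Z_def)
      also have "\<dots> \<le> (x + s) * (w (t - s) (x + s) - w (t - s) ((x + s) / 2))"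
        using moment_inequality[OF c_def, of "t - s" "x + s"] s x by (simp add: w_def Z_def K_def)
      finally have "\<phi>' s \<le> exp (- hazard x s) * (- ((x + s) * w (t - s) ((x + s) / 2)))"
        unfolding \<phi>'_def by (intro mult_left_mono) (auto simp: algebra_simps)
      then show "0 \<le> G s \<and> \<phi>' s \<le> - G s"
        using s x w0[of s "(x + s) / 2"] by (auto simp: G_def wait_density_def mult_ac)
    qed simp
    also have "\<phi> 0 = w t x" by (simp add: \<phi>_def)
    also have "\<phi> t = (x + t) ^ Suc n * exp (- hazard x t)" by (simp add: \<phi>_def w_def mult.commute)
    also have "ennreal \<dots> = ennreal ((x + t) ^ Suc n) * ennreal (exp (- hazard x t))"
      using x t by (intro ennreal_mult) auto
    also have "(\<integral>\<^sup>+s. ennreal (G s) * indicator {0..t} s \<partial>lborel) = (\<integral>\<^sup>+s. ennreal (wait_density x s) *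
      ennreal (w (t - s) ((x + s) / 2)) * indicator {0..t} s \<partial>lborel)"
      using x t by (intro nn_integral_cong)
        (auto simp: G_def ennreal_mult wait_density_nonneg w0 split: split_indicator)
    finally show ?thesis .
  qed
  have "tcp_semigroup (\<lambda>y. ennreal (y ^ Suc n)) t x \<le> ennreal (w t x)"
  proof (rule tcp_semigroup_le_supersolution[where w = "\<lambda>t x. ennreal (w t x)"])
    show "\<exists>C. \<forall>y. 0 \<le> y \<longrightarrow> y \<le> B \<longrightarrow> ennreal (y ^ Suc n) \<le> ennreal C" for B :: real
      by (intro exI[of _ "B ^ Suc n"]) (auto intro!: ennreal_leI mult_mono power_mono)
  qed (use t x super in auto)
  also have "ennreal (w t x) \<le> ennreal ((4 * real (Suc n) / t) ^ Suc n + K * t)"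
  proof (rule ennreal_leI)
    have "x / (1 + c * t * x) \<le> 1 / (c * t)"
      using t c x by (auto simp: divide_simps add_pos_nonneg)
    also have "\<dots> = 4 * real (Suc n) / t" by (simp add: c_def)
    finally show "w t x \<le> (4 * real (Suc n) / t) ^ Suc n + K * t"
      unfolding w_def using x t c by (intro add_right_mono power_mono) auto
  qed
  finally show ?thesis unfolding K_def .
qed

section \<open>The coupling\<close>

definition tcp_kernel :: "real \<times> real \<Rightarrow> real measure" where
  "tcp_kernel z = distr tcp_noise borel (\<lambda>\<omega>. tcp_path (snd z) \<omega> (fst z))"

lemma measurable_tcp_kernel [measurable]:
  "tcp_kernel \<in> borel \<Otimes>\<^sub>M borel \<rightarrow>\<^sub>M prob_algebra borel"
proof -
  have "(\<lambda>z. (fst (fst z), snd (fst z), snd z)) \<in>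
      (borel \<Otimes>\<^sub>M borel) \<Otimes>\<^sub>M tcp_noise \<rightarrow>\<^sub>M borel \<Otimes>\<^sub>M borel \<Otimes>\<^sub>M tcp_noise"
    by measurable
  from measurable_compose[OF this measurable_tcp_path_time]
  have [measurable]: "(\<lambda>z. tcp_path (snd (fst z)) (snd z) (fst (fst z))) \<in>
      borel_measurable ((borel \<Otimes>\<^sub>M borel) \<Otimes>\<^sub>M tcp_noise)"
    by (simp add: split_beta')
  show ?thesis
    unfolding tcp_kernel_def[abs_def]
    by (rule measurable_distr_prob_space2[where M = tcp_noise])
      (auto simp: space_prob_algebra prob_space_tcp_noise split_beta')
qed

lemma sets_tcp_kernel [simp, measurable_cong]: "sets (tcp_kernel z) = sets borel"
  by (simp add: tcp_kernel_def)

lemma prob_space_tcp_kernel: "prob_space (tcp_kernel z)"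
  unfolding tcp_kernel_def by (rule tcp_noise.prob_space_distr) measurable

lemma nn_integral_tcp_kernel:
  assumes "f \<in> borel_measurable borel"
  shows "(\<integral>\<^sup>+y. f y \<partial>tcp_kernel (t, x)) = tcp_semigroup f t x"
  using assms unfolding tcp_kernel_def tcp_semigroup_def by (subst nn_integral_distr) auto

abbreviation uniform_unit :: "real measure" where
  "uniform_unit \<equiv> uniform_measure lborel {0..1}"

interpretation uniform_unit: prob_space uniform_unit
  by (rule prob_space_uniform_measure) auto

text \<open>Jumps are proposed at rate \<open>m + s\<close>; the coordinate started at \<open>z\<close> accepts the proposal if the
  uniform mark \<open>v\<close> is at most \<open>(z + s) / (m + s)\<close>.\<close>

definition thinned_jump :: "real \<Rightarrow> real \<Rightarrow> real \<Rightarrow> real \<Rightarrow> real" where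
  "thinned_jump m s v z = (if v * (m + s) \<le> z + s then (z + s) / 2 else z + s)"

lemma measurable_thinned_jump [measurable (raw)]:
  assumes [measurable]: "a \<in> borel_measurable M" "b \<in> borel_measurable M" "c \<in> borel_measurable M"
    "d \<in> borel_measurable M"
  shows "(\<lambda>x. thinned_jump (a x) (b x) (c x) (d x)) \<in> borel_measurable M"
  unfolding thinned_jump_def by measurable

lemma thinned_jump_bounds:
  "0 \<le> z \<Longrightarrow> 0 \<le> s \<Longrightarrow> 0 \<le> thinned_jump m s v z \<and> thinned_jump m s v z \<le> z + s"
  by (auto simp: thinned_jump_def)

text \<open>Multiplying by the total rate \<open>R\<close> turns acceptance with probability
  \<open>r / R\<close> into the rates \<open>r\<close> and \<open>R - r\<close>, and keeps the
  degenerate case \<open>R = 0\<close> valid.\<close>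

lemma nn_integral_thinning:
  assumes "0 \<le> r" "r \<le> R"
  shows "ennreal R * (\<integral>\<^sup>+v. (if v * R \<le> r then a else b) \<partial>uniform_unit) =
    ennreal r * a + ennreal (R - r) * b"
proof (cases "R = 0")
  case False
  with assms have R: "0 < R" by simp
  have le: "v * R \<le> r \<longleftrightarrow> v \<le> r / R" for v
    using R by (simp add: pos_le_divide_eq)
  have "0 \<le> r / R" "r / R \<le> 1"
    using R assms by auto
  then have "(if v * R \<le> r then a else b) * indicator {0..1} v =
      a * indicator {0..r / R} v + b * indicator {r / R<..1} v" for v
    unfolding le by (cases "v \<le> r / R"; cases "0 \<le> v"; cases "v \<le> 1") simp_all
  then have "(\<integral>\<^sup>+v. (if v * R \<le> r then a else b) \<partial>uniform_unit) =
    (\<integral>\<^sup>+v. a * indicator {0..r / R} v + b * indicator {r / R<..1} v \<partial>lborel)"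
    by (subst nn_integral_uniform_measure) (simp_all add: divide_ennreal_def)
  also have "\<dots> = a * ennreal (r / R) + b * ennreal (1 - r / R)"
    using R assms by (subst nn_integral_add) (auto simp: nn_integral_cmult)
  finally show ?thesis
    using R assms by (simp add: distrib_left mult.left_commute[of "ennreal R"] algebra_simps flip: ennreal_mult)
qed (use assms in auto)

text \<open>Recursion on a budget of proposals makes each coupling a finite composition of kernels,
  so no infinite coupled path has to be built. A coordinate equal to the maximum accepts under every
  mark \<open>v \<le> 1\<close>.\<close>

primrec tcp_coupling :: "nat \<Rightarrow> real \<times> real \<times> real \<Rightarrow> (real \<times> real) measure" where
  "tcp_coupling 0 z = tcp_kernel (fst z, fst (snd z)) \<Otimes>\<^sub>M tcp_kernel (fst z, snd (snd z))"
| "tcp_coupling (Suc n) z =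
    (let t = fst z; x = fst (snd z); y = snd (snd z) in
     bind (std_exponential \<Otimes>\<^sub>M uniform_unit) (\<lambda>a. let s = tcp_wait (max x y) (fst a) in
       if t < s then return (borel \<Otimes>\<^sub>M borel) (x + t, y + t)
       else tcp_coupling n (t - s, thinned_jump (max x y) s (snd a) x, thinned_jump (max x y) s (snd a) y)))"

lemma marks_in_prob_algebra:
  "std_exponential \<Otimes>\<^sub>M uniform_unit \<in> space (prob_algebra (borel \<Otimes>\<^sub>M borel))"
  by (auto simp: space_prob_algebra intro!: prob_space_pair sets_pair_measure_cong
    std_exponential.prob_space_axioms uniform_unit.prob_space_axioms)

lemma measurable_tcp_coupling [measurable]:
  "tcp_coupling n \<in> borel \<Otimes>\<^sub>M borel \<Otimes>\<^sub>M borel \<rightarrow>\<^sub>M prob_algebra (borel \<Otimes>\<^sub>M borel)"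
proof (induction n)
  case 0
  show ?case unfolding tcp_coupling.simps by measurable
next
  case (Suc n)
  note [measurable] = Suc
  show ?case
    unfolding tcp_coupling.simps Let_def
    by (rule measurable_bind_prob_space2[where N = "borel \<Otimes>\<^sub>M borel"])
      (use marks_in_prob_algebra in \<open>simp_all add: split_beta'\<close>)
qed

lemma tcp_coupling_in_prob_algebra: "tcp_coupling n z \<in> space (prob_algebra (borel \<Otimes>\<^sub>M borel))"
  using measurable_space[OF measurable_tcp_coupling, of z n] by (simp add: space_pair_measure)

lemma sets_tcp_coupling [simp, measurable_cong]: "sets (tcp_coupling n z) = sets (borel \<Otimes>\<^sub>M borel)"
  using tcp_coupling_in_prob_algebra[of n z] by (simp add: space_prob_algebra)

lemma nn_integral_tcp_coupling_0:
  assumes [measurable]: "F \<in> borel_measurable (borel \<Otimes>\<^sub>M borel)"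
  shows "(\<integral>\<^sup>+z. F z \<partial>tcp_coupling 0 (t, x, y)) =
    tcp_semigroup (\<lambda>a. tcp_semigroup (\<lambda>b. F (a, b)) t y) t x"
proof -
  interpret Y: prob_space "tcp_kernel (t, y)" by (rule prob_space_tcp_kernel)
  have "(\<integral>\<^sup>+z. F z \<partial>tcp_coupling 0 (t, x, y)) =
    (\<integral>\<^sup>+a. \<integral>\<^sup>+b. F (a, b) \<partial>tcp_kernel (t, y) \<partial>tcp_kernel (t, x))"
    by (simp add: Y.nn_integral_fst)
  also have "\<dots> = (\<integral>\<^sup>+a. tcp_semigroup (\<lambda>b. F (a, b)) t y \<partial>tcp_kernel (t, x))"
    by (simp add: nn_integral_tcp_kernel)
  also have "\<dots> = tcp_semigroup (\<lambda>a. tcp_semigroup (\<lambda>b. F (a, b)) t y) t x"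
  proof (rule nn_integral_tcp_kernel)
    have "(\<lambda>a. \<integral>\<^sup>+b. F (a, b) \<partial>tcp_kernel (t, y)) \<in> borel_measurable borel"
      by (rule Y.borel_measurable_nn_integral) simp
    then show "(\<lambda>a. tcp_semigroup (\<lambda>b. F (a, b)) t y) \<in> borel_measurable borel"
      by (simp add: nn_integral_tcp_kernel)
  qed
  finally show ?thesis .
qed

text \<open>The renewal equation of the pair. The clock of the proposals is that of a single process
  started at \<open>m\<close>, because the flow moves both coordinates with the same slope.\<close>

lemma nn_integral_tcp_coupling_Suc:
  fixes t x y :: real
  defines "m \<equiv> max x y"
  assumes F [measurable]: "F \<in> borel_measurable (borel \<Otimes>\<^sub>M borel)" and t: "0 \<le> t" and m: "0 \<le> m"
  shows "(\<integral>\<^sup>+z. F z \<partial>tcp_coupling (Suc n) (t, x, y)) = F (x + t, y + t) * ennreal (exp (- hazard m t)) +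
    (\<integral>\<^sup>+s. ennreal (wait_density m s) * (\<integral>\<^sup>+v. (\<integral>\<^sup>+z. F z \<partial>tcp_coupling n
      (t - s, thinned_jump m s v x, thinned_jump m s v y)) \<partial>uniform_unit) * indicator {0..t} s \<partial>lborel)"
proof -
  define I where "I z = (\<integral>\<^sup>+a. F a \<partial>tcp_coupling n z)" for z
  have [measurable]: "I \<in> borel_measurable (borel \<Otimes>\<^sub>M borel \<Otimes>\<^sub>M borel)"
    unfolding I_def
    by (rule nn_integral_measurable_subprob_algebra2[where N = "borel \<Otimes>\<^sub>M borel"])
      (auto intro!: measurable_prob_algebraD)
  define g where "g a = (let s = tcp_wait m (fst a) in
       if t < s then return (borel \<Otimes>\<^sub>M borel) (x + t, y + t)
       else tcp_coupling n (t - s, thinned_jump m s (snd a) x, thinned_jump m s (snd a) y))" for a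
  have g: "g \<in> borel \<Otimes>\<^sub>M borel \<rightarrow>\<^sub>M prob_algebra (borel \<Otimes>\<^sub>M borel)"
    unfolding g_def Let_def by measurable
  have "(\<integral>\<^sup>+z. F z \<partial>tcp_coupling (Suc n) (t, x, y)) =
    (\<integral>\<^sup>+a. \<integral>\<^sup>+z. F z \<partial>g a \<partial>(std_exponential \<Otimes>\<^sub>M uniform_unit))"
    unfolding tcp_coupling.simps fst_conv snd_conv Let_def[of t] Let_def[of x] Let_def[of y]
      m_def[symmetric] g_def[symmetric]
    by (rule nn_integral_bind[OF F])
      (use measurable_prob_algebraD[OF g] in \<open>simp cong: measurable_cong_sets\<close>)
  also have "\<dots> = (\<integral>\<^sup>+a. (if t < tcp_wait m (fst a) then F (x + t, y + t)
      else I (t - tcp_wait m (fst a), thinned_jump m (tcp_wait m (fst a)) (snd a) x,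
        thinned_jump m (tcp_wait m (fst a)) (snd a) y)) \<partial>(std_exponential \<Otimes>\<^sub>M uniform_unit))"
    by (intro nn_integral_cong) (simp add: g_def Let_def I_def nn_integral_return space_pair_measure)
  also have "\<dots> = (\<integral>\<^sup>+e. \<integral>\<^sup>+v. (if t < tcp_wait m e then F (x + t, y + t)
      else I (t - tcp_wait m e, thinned_jump m (tcp_wait m e) v x,
        thinned_jump m (tcp_wait m e) v y)) \<partial>uniform_unit \<partial>std_exponential)"
    by (subst uniform_unit.nn_integral_fst[symmetric]) (simp_all cong: if_cong)
  also have "\<dots> = (\<integral>\<^sup>+e. (if t < tcp_wait m e then F (x + t, y + t)
      else (\<integral>\<^sup>+v. I (t - tcp_wait m e, thinned_jump m (tcp_wait m e) v x,
        thinned_jump m (tcp_wait m e) v y) \<partial>uniform_unit)) \<partial>std_exponential)"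
    by (intro nn_integral_cong) (simp add: uniform_unit.emeasure_space_1[simplified])
  also have "\<dots> = F (x + t, y + t) * ennreal (exp (- hazard m t)) +
    (\<integral>\<^sup>+s. ennreal (wait_density m s) * (\<integral>\<^sup>+v. I (t - s, thinned_jump m s v x, thinned_jump m s v y)
      \<partial>uniform_unit) * indicator {0..t} s \<partial>lborel)"
    using t m by (intro nn_integral_tcp_wait) simp_all
  finally show ?thesis by (simp add: I_def)
qed

section \<open>Marginals of the coupling\<close>

lemma wait_density_thinned:
  assumes "0 \<le> z" "z \<le> m" "0 \<le> s"
  shows "ennreal (wait_density m s) * (\<integral>\<^sup>+v. h (thinned_jump m s v z) \<partial>uniform_unit) =
    ennreal (exp (- hazard m s)) * (ennreal (z + s) * h ((z + s) / 2) + ennreal (m - z) * h (z + s))"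
proof -
  have "ennreal (wait_density m s) * (\<integral>\<^sup>+v. h (thinned_jump m s v z) \<partial>uniform_unit) =
    ennreal (exp (- hazard m s)) * (ennreal (m + s) *
      (\<integral>\<^sup>+v. (if v * (m + s) \<le> z + s then h ((z + s) / 2) else h (z + s)) \<partial>uniform_unit))"
    using assms by (simp add: wait_density_def ennreal_mult thinned_jump_def if_distrib[of h] mult_ac
      del: ennreal_plus)
  also have "\<dots> = ennreal (exp (- hazard m s)) * (ennreal (z + s) * h ((z + s) / 2) + ennreal (m - z) * h (z + s))"
    using assms by (subst nn_integral_thinning) auto
  finally show ?thesis .
qed

text \<open>Each coordinate alone sees a thinned process. The dominating rate changes at every
  proposal with the new maximum, but \<open>tcp_semigroup_thinned\<close> holds for every
  \<open>m\<close> above the coordinate, so each induction step may use its own \<open>m\<close>. At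
  budget 0 the marginals are exact because the continuation is a product.\<close>

lemma tcp_coupling_marginals:
  assumes f [measurable]: "f \<in> borel_measurable borel" and "0 \<le> t" "0 \<le> x" "0 \<le> y"
  shows "(\<integral>\<^sup>+z. f (fst z) \<partial>tcp_coupling n (t, x, y)) = tcp_semigroup f t x"
    and "(\<integral>\<^sup>+z. f (snd z) \<partial>tcp_coupling n (t, x, y)) = tcp_semigroup f t y"
proof -
  have "(\<integral>\<^sup>+z. f (fst z) \<partial>tcp_coupling n (t, x, y)) = tcp_semigroup f t x \<and>
    (\<integral>\<^sup>+z. f (snd z) \<partial>tcp_coupling n (t, x, y)) = tcp_semigroup f t y"
    using assms(2-)
  proof (induction n arbitrary: t x y)
    case 0
    have [simp]: "tcp_semigroup (\<lambda>_. c) t x = c" for c t x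
      by (simp add: tcp_semigroup_def tcp_noise.emeasure_space_1[simplified])
    show ?case by (subst (1 2) nn_integral_tcp_coupling_0) simp_all
  next
    case (Suc n)
    define m where "m = max x y"
    have m: "0 \<le> m" "x \<le> m" "y \<le> m" using Suc.prems by (auto simp: m_def)
    have IH: "(\<integral>\<^sup>+z. f (fst z) \<partial>tcp_coupling n (t - s, thinned_jump m s v x, thinned_jump m s v y)) =
        tcp_semigroup f (t - s) (thinned_jump m s v x)"
      "(\<integral>\<^sup>+z. f (snd z) \<partial>tcp_coupling n (t - s, thinned_jump m s v x, thinned_jump m s v y)) =
        tcp_semigroup f (t - s) (thinned_jump m s v y)" if "s \<in> {0..t}" for s v
      using Suc.IH[of "t - s" "thinned_jump m s v x" "thinned_jump m s v y"] that Suc.prems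
        thinned_jump_bounds[of _ s m v] by auto
    have step: "f (z + t) * ennreal (exp (- hazard m t)) +
      (\<integral>\<^sup>+s. ennreal (wait_density m s) * (\<integral>\<^sup>+v. tcp_semigroup f (t - s) (thinned_jump m s v z)
        \<partial>uniform_unit) * indicator {0..t} s \<partial>lborel) = tcp_semigroup f t z" if "0 \<le> z" "z \<le> m" for z
      unfolding tcp_semigroup_thinned[OF that Suc.prems(1) f]
      using that by (intro arg_cong2[where f = "(+)"] nn_integral_cong)
        (auto split: split_indicator simp: wait_density_thinned)
    show ?case
    proof
      have "(\<integral>\<^sup>+z. f (fst z) \<partial>tcp_coupling (Suc n) (t, x, y)) = f (x + t) * ennreal (exp (- hazard m t)) +
        (\<integral>\<^sup>+s. ennreal (wait_density m s) * (\<integral>\<^sup>+v. tcp_semigroup f (t - s) (thinned_jump m s v x)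
          \<partial>uniform_unit) * indicator {0..t} s \<partial>lborel)"
        unfolding nn_integral_tcp_coupling_Suc[of "\<lambda>z. f (fst z)" t x y n, folded m_def,
            OF _ Suc.prems(1) m(1), OF measurable_compose[OF measurable_fst f]] fst_conv
        by (intro arg_cong2[where f = "(+)"] refl nn_integral_cong) (simp add: IH split: split_indicator)
      then show "(\<integral>\<^sup>+z. f (fst z) \<partial>tcp_coupling (Suc n) (t, x, y)) = tcp_semigroup f t x"
        using step[of x] m Suc.prems by simp
      have "(\<integral>\<^sup>+z. f (snd z) \<partial>tcp_coupling (Suc n) (t, x, y)) = f (y + t) * ennreal (exp (- hazard m t)) +
        (\<integral>\<^sup>+s. ennreal (wait_density m s) * (\<integral>\<^sup>+v. tcp_semigroup f (t - s) (thinned_jump m s v y)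
          \<partial>uniform_unit) * indicator {0..t} s \<partial>lborel)"
        unfolding nn_integral_tcp_coupling_Suc[of "\<lambda>z. f (snd z)" t x y n, folded m_def,
            OF _ Suc.prems(1) m(1), OF measurable_compose[OF measurable_snd f]] snd_conv
        by (intro arg_cong2[where f = "(+)"] refl nn_integral_cong) (simp add: IH split: split_indicator)
      then show "(\<integral>\<^sup>+z. f (snd z) \<partial>tcp_coupling (Suc n) (t, x, y)) = tcp_semigroup f t y"
        using step[of y] m Suc.prems by simp
    qed
  qed
  then show "(\<integral>\<^sup>+z. f (fst z) \<partial>tcp_coupling n (t, x, y)) = tcp_semigroup f t x"
    and "(\<integral>\<^sup>+z. f (snd z) \<partial>tcp_coupling n (t, x, y)) = tcp_semigroup f t y" by auto
qed

section \<open>Contraction\<close>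

text \<open>The rate \<open>121 / 1000\<close> lies just above the \<open>\<kappa>\<close> of the theorem.\<close>

definition weight :: "real \<Rightarrow> real" where
  "weight r = exp (- (121 / 1000) * min r (7 / 5))"

definition coupling_cost :: "real \<times> real \<Rightarrow> real" where
  "coupling_cost z = sqrt \<bar>fst z - snd z\<bar> * weight (max (fst z) (snd z))"

lemma weight_pos: "0 < weight r"
  by (simp add: weight_def)

lemma weight_antimono: "r \<le> r' \<Longrightarrow> weight r' \<le> weight r"
  by (auto simp: weight_def)

lemma weight_le_1: "0 \<le> r \<Longrightarrow> weight r \<le> 1"
  by (simp add: weight_def)

lemma weight_bound: "exp (- (121 / 1000) * (7 / 5)) \<le> weight r"
  unfolding weight_def by (subst exp_le_cancel_iff) (auto simp: min_def)

lemma measurable_weight [measurable]: "weight \<in> borel_measurable borel"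
  unfolding weight_def[abs_def] by measurable

lemma measurable_coupling_cost [measurable]: "coupling_cost \<in> borel_measurable (borel \<Otimes>\<^sub>M borel)"
  unfolding coupling_cost_def[abs_def] by measurable

lemma coupling_cost_nonneg: "0 \<le> coupling_cost z"
  using weight_pos[of "max (fst z) (snd z)"] by (simp add: coupling_cost_def)

lemma coupling_cost_commute: "coupling_cost (x, y) = coupling_cost (y, x)"
  by (simp add: coupling_cost_def abs_minus_commute max.commute)

text \<open>After dividing by \<open>sqrt d\<close>, the claim is \<open>b / sqrt 2 + sqrt (d * \<bar>d - b\<bar> / 2) \<le> M (b + d)\<close>, whose
  best constant \<open>M = sqrt 2 * (3 + sqrt 3) / 8\<close> is slightly below \<open>419 / 500\<close>.\<close>

lemma sqrt_jump_factor:
  assumes b: "0 \<le> b" and d: "0 \<le> d"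
  shows "b * sqrt (d / 2) + d * sqrt (\<bar>d - b\<bar> / 2) \<le> 419 / 500 * (b + d) * sqrt d"
proof -
  \<comment> \<open>Upper bound for 1 / sqrt 2. Subtracting it from 419 / 500 leaves the coefficient
    1308 / 10000 of \<open>b\<close> in the next claim.\<close>
  have half: "sqrt (1 / 2) \<le> 7072 / 10000"
    by (rule real_le_lsqrt) (simp_all add: power2_eq_square)
  have "sqrt (d * \<bar>d - b\<bar> / 2) \<le> 1308 / 10000 * b + 8380 / 10000 * d"
  proof (rule real_le_lsqrt)
    show "d * \<bar>d - b\<bar> / 2 \<le> (1308 / 10000 * b + 8380 / 10000 * d)\<^sup>2"
    proof -
      have nn: "0 \<le> b * b" "0 \<le> b * d" "0 \<le> d * d" using b d by auto
      have sq: "(1308 / 10000 * b + 8380 / 10000 * d)\<^sup>2 =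
        1710864 / 100000000 * (b * b) + 21922080 / 100000000 * (b * d) + 70224400 / 100000000 * (d * d)"
        by (simp add: power2_eq_square algebra_simps)
      show ?thesis
      proof (cases "b \<le> d")
        case True
        then have "d * \<bar>d - b\<bar> / 2 = d * d / 2 - b * d / 2" by (simp add: right_diff_distrib diff_divide_distrib)
        then show ?thesis unfolding sq using nn by linarith
      next
        case False
        then have "d * \<bar>d - b\<bar> / 2 = b * d / 2 - d * d / 2" by (simp add: right_diff_distrib diff_divide_distrib)
        \<comment> \<open>Completing the square: after moving \<open>b * d / 2 - d * d / 2\<close>
          to the right, the quadratic form has mixed coefficient about - 0.28078. The value 10737 /
          10000 makes that of the square slightly more negative while keeping its
          \<open>d * d\<close> coefficient below 1.2022.\<close>
        moreover have "(1308 / 10000 * b - 10737 / 10000 * d)\<^sup>2 =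
          1710864 / 100000000 * (b * b) - 28087992 / 100000000 * (b * d) + 115283169 / 100000000 * (d * d)"
          by (simp add: power2_eq_square algebra_simps)
        moreover have "0 \<le> (1308 / 10000 * b - 10737 / 10000 * d)\<^sup>2" by simp
        ultimately show ?thesis unfolding sq using nn by linarith
      qed
    qed
  qed (use b d in auto)
  moreover have "b * sqrt (1 / 2) \<le> b * (7072 / 10000)"
    using half b by (rule mult_left_mono)
  ultimately have "b * sqrt (1 / 2) + sqrt (d * \<bar>d - b\<bar> / 2) \<le> 419 / 500 * (b + d)"
    by (simp add: algebra_simps)
  then have "(b * sqrt (1 / 2) + sqrt (d * \<bar>d - b\<bar> / 2)) * sqrt d \<le> 419 / 500 * (b + d) * sqrt d"
    using d by (intro mult_right_mono) auto
  moreover have "sqrt (1 / 2) * sqrt d = sqrt (d / 2)"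
    by (simp flip: real_sqrt_mult)
  moreover have "sqrt (d * \<bar>d - b\<bar> / 2) * sqrt d = d * sqrt (\<bar>d - b\<bar> / 2)"
  proof -
    have "sqrt (d * \<bar>d - b\<bar> / 2) = sqrt d * sqrt (\<bar>d - b\<bar> / 2)"
      by (simp flip: real_sqrt_mult)
    then show ?thesis using d by (simp add: mult_ac)
  qed
  ultimately show ?thesis by (simp add: distrib_right mult.assoc)
qed

text \<open>By symmetry let \<open>y \<le> x\<close>. The larger coordinate always goes to
  \<open>a / 2\<close>, while the smaller one ends at \<open>b / 2\<close> or \<open>b\<close>. In
  the latter case the new maximum may be \<open>b\<close>, which only lowers the weight, so
  \<open>weight (a / 2)\<close> bounds both cases and \<open>sqrt_jump_factor\<close>
  finishes.\<close>

lemma coupling_cost_thinned_jump: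
  fixes x y :: real
  defines "m \<equiv> max x y"
  assumes x: "0 \<le> x" and y: "0 \<le> y" and s: "0 \<le> s"
  shows "ennreal (m + s) * (\<integral>\<^sup>+v. ennreal (coupling_cost (thinned_jump m s v x, thinned_jump m s v y)) \<partial>uniform_unit)
    \<le> ennreal (419 / 500 * (m + s) * sqrt \<bar>x - y\<bar> * weight ((m + s) / 2))"
proof -
  have *: "ennreal (x + s) * (\<integral>\<^sup>+v. ennreal (coupling_cost (thinned_jump x s v x, thinned_jump x s v y)) \<partial>uniform_unit)
    \<le> ennreal (419 / 500 * (x + s) * sqrt \<bar>x - y\<bar> * weight ((x + s) / 2))"
    if y: "0 \<le> y" and yx: "y \<le> x" for x y
  proof -
    define a b d where "a = x + s" and "b = y + s" and "d = x - y"
    have abd: "0 \<le> b" "b \<le> a" "0 \<le> d" "a = b + d" using y yx s by (auto simp: a_def b_def d_def)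
    have "AE v in uniform_unit. v \<in> {0..1}"
      by (rule AE_uniform_measureI) auto
    then have "(\<integral>\<^sup>+v. ennreal (coupling_cost (thinned_jump x s v x, thinned_jump x s v y)) \<partial>uniform_unit) =
      (\<integral>\<^sup>+v. (if v * a \<le> b then ennreal (coupling_cost (a / 2, b / 2)) else ennreal (coupling_cost (a / 2, b))) \<partial>uniform_unit)"
    proof (intro nn_integral_cong_AE, eventually_elim)
      case (elim v)
      then have "v * (x + s) \<le> x + s" using abd by (intro mult_left_le_one_le) (auto simp: a_def)
      then show ?case by (simp add: thinned_jump_def a_def b_def)
    qed
    then have "ennreal (x + s) * (\<integral>\<^sup>+v. ennreal (coupling_cost (thinned_jump x s v x, thinned_jump x s v y)) \<partial>uniform_unit)
      = ennreal b * ennreal (coupling_cost (a / 2, b / 2)) + ennreal (a - b) * ennreal (coupling_cost (a / 2, b))"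
      using nn_integral_thinning[OF abd(1,2)] by (simp add: a_def)
    also have "\<dots> = ennreal (b * coupling_cost (a / 2, b / 2) + d * coupling_cost (a / 2, b))"
      using abd coupling_cost_nonneg by (subst ennreal_plus) (auto simp: ennreal_mult)
    also have "\<dots> \<le> ennreal (419 / 500 * a * sqrt d * weight (a / 2))"
    proof (rule ennreal_leI)
      have "coupling_cost (a / 2, b / 2) = sqrt (d / 2) * weight (a / 2)"
        using abd by (simp add: coupling_cost_def max_def flip: diff_divide_distrib)
      moreover have "coupling_cost (a / 2, b) \<le> sqrt (\<bar>d - b\<bar> / 2) * weight (a / 2)"
      proof -
        have eq: "\<bar>a / 2 - b\<bar> = \<bar>d - b\<bar> / 2" using abd by (auto simp: abs_if field_simps)
        show ?thesis unfolding coupling_cost_def fst_conv snd_conv eq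
          by (intro mult_left_mono weight_antimono) auto
      qed
      ultimately have "b * coupling_cost (a / 2, b / 2) + d * coupling_cost (a / 2, b) \<le>
        b * (sqrt (d / 2) * weight (a / 2)) + d * (sqrt (\<bar>d - b\<bar> / 2) * weight (a / 2))"
        using abd by (intro add_mono mult_left_mono) auto
      also have "\<dots> = (b * sqrt (d / 2) + d * sqrt (\<bar>d - b\<bar> / 2)) * weight (a / 2)"
        by (simp add: algebra_simps)
      also have "\<dots> \<le> 419 / 500 * (b + d) * sqrt d * weight (a / 2)"
        using sqrt_jump_factor[OF abd(1,3)] weight_pos[of "a / 2"] by (intro mult_right_mono) auto
      finally show "b * coupling_cost (a / 2, b / 2) + d * coupling_cost (a / 2, b) \<le>
        419 / 500 * a * sqrt d * weight (a / 2)" using abd by simp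
    qed
    finally show ?thesis using abd by (simp add: a_def d_def)
  qed
  show ?thesis
  proof (cases "y \<le> x")
    case True
    then show ?thesis using *[OF y True] by (simp add: m_def max_def)
  next
    case False
    then show ?thesis using *[of x y] x
      by (simp add: m_def max_def coupling_cost_commute[of _ "thinned_jump y _ _ y"] abs_minus_commute)
  qed
qed

section \<open>Numerical inequalities for the weight\<close>

text \<open>The exponent is 121 / 1000 * (7 / 10), the largest gain in the exponent of
  \<open>weight\<close> from halving its argument. It is divided by 4 because the quadratic bound of
  \<open>exp_bound\<close> applied directly gives about 1.0919, which is too large.\<close>

lemma exp_bound_numeric: "exp (847 / 10000 :: real) \<le> 10895 / 10000"
proof -
  have "exp (847 / 40000 :: real) \<le> 1 + 847 / 40000 + (847 / 40000)\<^sup>2"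
    by (rule exp_bound) auto
  then have "exp (847 / 40000 :: real) ^ 4 \<le> (1 + 847 / 40000 + (847 / 40000)\<^sup>2) ^ 4"
    by (intro power_mono) auto
  also have "\<dots> \<le> 10895 / 10000"
    by (simp add: power2_eq_square power4_eq_xxxx)
  finally show ?thesis by (simp flip: exp_of_nat_mult)
qed

text \<open>The gap \<open>min r (7 / 5) - min (r / 2) (7 / 5)\<close> is largest at
  \<open>r = 7 / 5\<close>, where it equals 7 / 10.\<close>

lemma weight_half: "weight (r / 2) \<le> 10895 / 10000 * weight r" if "0 \<le> r"
proof -
  have "weight (r / 2) \<le> exp (847 / 10000) * weight r"
    unfolding weight_def mult_exp_exp using that by (simp add: min_def)
  also have "\<dots> \<le> 10895 / 10000 * weight r"
    using exp_bound_numeric weight_pos[of r] by (intro mult_right_mono) auto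
  finally show ?thesis .
qed

text \<open>This is where the constants meet. The product 419 / 500 * (10895 / 10000) is about
  0.9130, below 1, which settles \<open>r \<le> 7 / 5\<close>. Beyond 7 / 5 the surplus is at least
  (1 - 0.9131) * 7 / 5 > 0.1216, which exceeds 121 / 1000.\<close>

lemma weight_inequality:
  assumes "0 \<le> r"
  shows "419 / 500 * r * weight (r / 2) \<le> (r - (if 7 / 5 < r then 121 / 1000 else 0)) * weight r"
proof -
  have "419 / 500 * r * weight (r / 2) \<le> 419 / 500 * r * (10895 / 10000 * weight r)"
    using assms weight_half by (intro mult_left_mono) auto
  also have "\<dots> = (419 / 500 * (10895 / 10000) * r) * weight r"
    by simp
  also have "\<dots> \<le> (r - (if 7 / 5 < r then 121 / 1000 else 0)) * weight r"
    using assms weight_pos[of r] by (intro mult_right_mono) (auto simp: field_simps)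
  finally show ?thesis .
qed

text \<open>Between proposals only the weight changes. Up to 7 / 5 its logarithmic slope - \<mu>
  exactly cancels the growth of the factor \<open>exp (- \<mu> (t - s))\<close>, so proposals must
  merely not increase the cost; beyond 7 / 5 the weight is flat and proposals must supply the rate
  \<mu>. Both demands are \<open>weight_inequality\<close>.\<close>

lemma coupling_cost_supersolution:
  fixes x y :: real
  defines "m \<equiv> max x y"
  assumes t: "0 \<le> t" and x: "0 \<le> x" and y: "0 \<le> y"
  shows "ennreal (coupling_cost (x + t, y + t)) * ennreal (exp (- hazard m t)) +
    (\<integral>\<^sup>+s. ennreal (wait_density m s) * (\<integral>\<^sup>+v. ennreal (exp (- (121 / 1000) * (t - s)) *
      coupling_cost (thinned_jump m s v x, thinned_jump m s v y)) \<partial>uniform_unit) * indicator {0..t} s \<partial>lborel)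
    \<le> ennreal (exp (- (121 / 1000) * t) * coupling_cost (x, y))"
proof -
  let ?\<mu> = "121 / 1000 :: real"
  define d where "d = \<bar>x - y\<bar>"
  have m: "0 \<le> m" using x y by (simp add: m_def)
  define \<phi> where "\<phi> s = exp (- ?\<mu> * (t - s)) * sqrt d * weight (m + s) * exp (- hazard m s)" for s
  define \<phi>' where "\<phi>' s = - ((m + s) - (if 7 / 5 < m + s then ?\<mu> else 0)) * \<phi> s" for s
  define G where "G s = exp (- hazard m s) * (exp (- ?\<mu> * (t - s)) *
    (419 / 500 * (m + s) * sqrt d * weight ((m + s) / 2)))" for s
  have cost: "coupling_cost (x + s, y + s) = sqrt d * weight (m + s)" for s
    by (simp add: coupling_cost_def d_def m_def max_def)
  have "ennreal (\<phi> t) + (\<integral>\<^sup>+s. ennreal (G s) * indicator {0..t} s \<partial>lborel) \<le> ennreal (\<phi> 0)"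
  proof (rule nn_integral_le_decrement[OF t, of "{7 / 5 - m}" \<phi> \<phi>'])
    show "continuous_on {0..t} \<phi>"
      unfolding \<phi>_def[abs_def] weight_def hazard_def by (intro continuous_intros) auto
    show "0 \<le> \<phi> t" using weight_pos[of "m + t"] by (simp add: \<phi>_def d_def)
    fix s assume s: "0 < s" "s < t" "s \<notin> {7 / 5 - m}"
    have dE: "((\<lambda>s. exp (- hazard m s)) has_real_derivative - wait_density m s) (at s)"
      using DERIV_minus[OF has_derivative_exp_hazard[of m s]] by simp
    have dW: "((\<lambda>s. weight (m + s)) has_real_derivative
        (if 7 / 5 < m + s then 0 else - ?\<mu> * weight (m + s))) (at s)"
    proof (cases "7 / 5 < m + s")
      case True
      have "((\<lambda>s. exp (- ?\<mu> * (7 / 5))) has_real_derivative 0) (at s)" by simp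
      moreover have "\<forall>\<^sub>F r in nhds s. weight (m + r) = exp (- ?\<mu> * (7 / 5))"
        using eventually_nhds_in_open[of "{7 / 5 - m<..}" s] True
        by (auto elim!: eventually_mono simp: weight_def)
      ultimately show ?thesis using True by (subst DERIV_cong_ev[OF refl _ refl]) auto
    next
      case False
      have "((\<lambda>s. exp (- ?\<mu> * (m + s))) has_real_derivative - ?\<mu> * exp (- ?\<mu> * (m + s))) (at s)"
        by (auto intro!: derivative_eq_intros)
      moreover have "\<forall>\<^sub>F r in nhds s. weight (m + r) = exp (- ?\<mu> * (m + r))"
        using eventually_nhds_in_open[of "{..<7 / 5 - m}" s] False s
        by (auto elim!: eventually_mono simp: weight_def)
      moreover have "weight (m + s) = exp (- ?\<mu> * (m + s))"
        using False by (simp add: weight_def)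
      ultimately show ?thesis using False by (subst DERIV_cong_ev[OF refl _ refl]) auto
    qed
    have dX: "((\<lambda>s. exp (- ?\<mu> * (t - s)) * sqrt d) has_real_derivative
      ?\<mu> * (exp (- ?\<mu> * (t - s)) * sqrt d)) (at s)"
      by (auto intro!: derivative_eq_intros)
    show "(\<phi> has_real_derivative \<phi>' s) (at s)"
      using DERIV_mult[OF DERIV_mult[OF dX dW] dE] unfolding \<phi>_def[abs_def] \<phi>'_def
      by (rule DERIV_cong) (simp add: wait_density_def algebra_simps)
    define k where "k = (m + s) - (if 7 / 5 < m + s then ?\<mu> else 0)"
    define P where "P = exp (- hazard m s) * exp (- ?\<mu> * (t - s)) * sqrt d"
    have "419 / 500 * (m + s) * weight ((m + s) / 2) \<le> k * weight (m + s)"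
      using weight_inequality[of "m + s"] m s by (simp add: k_def)
    then have "P * (419 / 500 * (m + s) * weight ((m + s) / 2)) \<le> P * (k * weight (m + s))"
      by (rule mult_left_mono) (simp add: P_def d_def)
    moreover have "G s = P * (419 / 500 * (m + s) * weight ((m + s) / 2))"
      by (simp only: G_def P_def mult_ac)
    moreover have "\<phi>' s = - (P * (k * weight (m + s)))"
      by (simp only: \<phi>'_def \<phi>_def P_def k_def[symmetric] mult_ac minus_mult_left)
    ultimately have "\<phi>' s \<le> - G s" by simp
    moreover have "0 \<le> G s" using m s weight_pos[of "(m + s) / 2"] by (simp add: G_def d_def)
    ultimately show "0 \<le> G s \<and> \<phi>' s \<le> - G s" by simp
  qed simp
  also have "\<phi> 0 = exp (- ?\<mu> * t) * coupling_cost (x, y)"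
    using cost[of 0] by (simp add: \<phi>_def)
  also have "ennreal (\<phi> t) = ennreal (coupling_cost (x + t, y + t)) * ennreal (exp (- hazard m t))"
    using coupling_cost_nonneg[of "(x + t, y + t)"] by (simp add: \<phi>_def cost ennreal_mult)
  finally have *: "ennreal (coupling_cost (x + t, y + t)) * ennreal (exp (- hazard m t)) +
    (\<integral>\<^sup>+s. ennreal (G s) * indicator {0..t} s \<partial>lborel) \<le> ennreal (exp (- ?\<mu> * t) * coupling_cost (x, y))" .
  have "ennreal (wait_density m s) * (\<integral>\<^sup>+v. ennreal (exp (- ?\<mu> * (t - s)) *
      coupling_cost (thinned_jump m s v x, thinned_jump m s v y)) \<partial>uniform_unit) \<le> ennreal (G s)"
    if s: "0 \<le> s" for s
  proof -
    have "(\<integral>\<^sup>+v. ennreal (exp (- ?\<mu> * (t - s)) *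
      coupling_cost (thinned_jump m s v x, thinned_jump m s v y)) \<partial>uniform_unit) =
      ennreal (exp (- ?\<mu> * (t - s))) *
        (\<integral>\<^sup>+v. ennreal (coupling_cost (thinned_jump m s v x, thinned_jump m s v y)) \<partial>uniform_unit)"
      by (subst nn_integral_cmult[symmetric]) (auto simp: ennreal_mult coupling_cost_nonneg)
    then have "ennreal (wait_density m s) * (\<integral>\<^sup>+v. ennreal (exp (- ?\<mu> * (t - s)) *
      coupling_cost (thinned_jump m s v x, thinned_jump m s v y)) \<partial>uniform_unit) =
      ennreal (exp (- hazard m s)) * (ennreal (exp (- ?\<mu> * (t - s))) * (ennreal (m + s) *
        (\<integral>\<^sup>+v. ennreal (coupling_cost (thinned_jump m s v x, thinned_jump m s v y)) \<partial>uniform_unit)))"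
      using m s by (simp add: wait_density_def ennreal_mult mult_ac del: ennreal_plus)
    also have "\<dots> \<le> ennreal (exp (- hazard m s)) * (ennreal (exp (- ?\<mu> * (t - s))) *
        ennreal (419 / 500 * (m + s) * sqrt d * weight ((m + s) / 2)))"
      using coupling_cost_thinned_jump[OF x y s] unfolding m_def d_def
      by (intro mult_left_mono) auto
    also have "\<dots> = ennreal (G s)"
    proof -
      have "ennreal (a * (b * c)) = ennreal a * (ennreal b * ennreal c)" if "0 \<le> a" "0 \<le> b" "0 \<le> c" for a b c
        using that by (simp add: ennreal_mult)
      from this[symmetric] show ?thesis
        unfolding G_def by (rule) (use m s weight_pos[of "(m + s) / 2"] in \<open>auto simp: d_def\<close>)
    qed
    finally show ?thesis .
  qed
  then show ?thesis
    by (intro order_trans[OF add_left_mono *] nn_integral_mono) (auto split: split_indicator)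
qed

lemma sqrt_le_one_plus: "0 \<le> r \<Longrightarrow> sqrt r \<le> 1 + r"
  by (rule real_le_lsqrt) (auto simp: power2_eq_square algebra_simps)

text \<open>The second summand is the truncation error: once the budget is exhausted, the cost of
  the independent continuation is still at most \<open>1 + B\<close>, and positions and proposal
  rates stay below \<open>B = max x y + t\<close>.\<close>

lemma tcp_coupling_cost_bound:
  assumes t: "0 \<le> t" and x: "0 \<le> x" and y: "0 \<le> y"
  shows "(\<integral>\<^sup>+z. ennreal (coupling_cost z) \<partial>tcp_coupling n (t, x, y)) \<le>
    ennreal (exp (- (121 / 1000) * t) * coupling_cost (x, y)) +
    ennreal ((1 + (max x y + t)) * ((max x y + t) * t) ^ n / fact n)"
proof -
  define B where "B = max x y + t"
  define D where "D t = {z :: real \<times> real. 0 \<le> t \<and> 0 \<le> fst z \<and> 0 \<le> snd z \<and> fst z + t \<le> B \<and> snd z + t \<le> B}" for t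
  define J where "J z s v = (thinned_jump (max (fst z) (snd z)) s v (fst z),
    thinned_jump (max (fst z) (snd z)) s v (snd z))" for z s v
  have B: "0 \<le> B" using t x by (simp add: B_def)
  have "(\<integral>\<^sup>+z. ennreal (coupling_cost z) \<partial>tcp_coupling n (t, fst (x, y), snd (x, y))) \<le>
    ennreal (exp (- (121 / 1000) * t) * coupling_cost (x, y)) + ennreal ((1 + B) * (B * t) ^ n / fact n)"
  proof (rule supersolution_bound[where D = D and U = uniform_unit and J = J
        and q = "\<lambda>z. wait_density (max (fst z) (snd z))"
        and u = "\<lambda>n t z. \<integral>\<^sup>+a. ennreal (coupling_cost a) \<partial>tcp_coupling n (t, fst z, snd z)"
        and w = "\<lambda>t z. ennreal (exp (- (121 / 1000) * t) * coupling_cost z)"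
        and g = "\<lambda>t z. ennreal (coupling_cost (fst z + t, snd z + t)) *
          ennreal (exp (- hazard (max (fst z) (snd z)) t))"])
    fix r z assume z: "z \<in> D r"
    then have r: "0 \<le> r" and z0: "0 \<le> fst z" "0 \<le> snd z" and zB: "fst z + r \<le> B" "snd z + r \<le> B"
      by (auto simp: D_def)
    show "J z s v \<in> D (r - s)" if "0 \<le> s" "s \<le> r" for s v
      using that z0 zB thinned_jump_bounds[OF z0(1) that(1), of "max (fst z) (snd z)" v]
        thinned_jump_bounds[OF z0(2) that(1), of "max (fst z) (snd z)" v]
      by (auto simp: D_def J_def)
    show "0 \<le> r" by fact
    show "wait_density (max (fst z) (snd z)) s \<le> B" if "0 \<le> s" "s \<le> r" for s
    proof -
      have "0 \<le> max (fst z) (snd z)" using z0 by simp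
      from wait_density_le[OF this that(1)] show ?thesis using that zB by simp
    qed
    show "(\<lambda>(s, v). ennreal (exp (- (121 / 1000) * (r - s)) * coupling_cost (J z s v)))
      \<in> borel_measurable (borel \<Otimes>\<^sub>M uniform_unit)"
    proof -
      have "(\<lambda>(s, v). ennreal (exp (- (121 / 1000) * (r - s)) * coupling_cost (J z s v)))
        \<in> borel_measurable (borel \<Otimes>\<^sub>M borel)"
        unfolding J_def by measurable
      then show ?thesis by (simp cong: measurable_cong_sets)
    qed
    show "(\<integral>\<^sup>+a. ennreal (coupling_cost a) \<partial>tcp_coupling (Suc n) (r, fst z, snd z)) \<le>
      ennreal (coupling_cost (fst z + r, snd z + r)) * ennreal (exp (- hazard (max (fst z) (snd z)) r)) +
      (\<integral>\<^sup>+s. ennreal (wait_density (max (fst z) (snd z)) s) * (\<integral>\<^sup>+v. (\<integral>\<^sup>+a. ennreal (coupling_cost a)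
        \<partial>tcp_coupling n (r - s, fst (J z s v), snd (J z s v))) \<partial>uniform_unit) * indicator {0..r} s \<partial>lborel)" for n
      using r z0 by (subst nn_integral_tcp_coupling_Suc) (auto simp: J_def)
    show "ennreal (coupling_cost (fst z + r, snd z + r)) * ennreal (exp (- hazard (max (fst z) (snd z)) r)) +
      (\<integral>\<^sup>+s. ennreal (wait_density (max (fst z) (snd z)) s) * (\<integral>\<^sup>+v. ennreal (exp (- (121 / 1000) * (r - s)) *
        coupling_cost (J z s v)) \<partial>uniform_unit) * indicator {0..r} s \<partial>lborel)
      \<le> ennreal (exp (- (121 / 1000) * r) * coupling_cost z)"
      using coupling_cost_supersolution[OF r z0] by (simp add: J_def)
    have "coupling_cost (a, b) \<le> 1 + B" if "0 \<le> a" "a \<le> B" "0 \<le> b" "b \<le> B" for a b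
    proof -
      have "sqrt \<bar>a - b\<bar> \<le> 1 + \<bar>a - b\<bar>"
        by (rule sqrt_le_one_plus) simp
      also have "\<dots> \<le> 1 + B" using that by auto
      finally show ?thesis
        using weight_le_1[of "max a b"] weight_pos[of "max a b"] that
        by (simp add: coupling_cost_def) (smt (verit) mult_left_le real_sqrt_ge_zero)
    qed
    then show "(\<integral>\<^sup>+a. ennreal (coupling_cost a) \<partial>tcp_coupling 0 (r, fst z, snd z)) \<le> ennreal (1 + B)"
      using z0 zB r unfolding nn_integral_tcp_coupling_0[OF measurable_compose[OF measurable_coupling_cost measurable_ennreal]]
      by (intro tcp_semigroup_bounded ennreal_leI) auto
  qed (use t x y B uniform_unit.prob_space_axioms in \<open>auto simp: D_def B_def\<close>)
  then show ?thesis by (simp add: B_def)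
qed

section \<open>Laws\<close>

lemma nn_integral_tcp_law:
  assumes \<nu>: "prob_on_nonneg \<nu>" and f [measurable]: "f \<in> borel_measurable borel"
  shows "(\<integral>\<^sup>+y. f y \<partial>tcp_law \<nu> t) = (\<integral>\<^sup>+x. tcp_semigroup f t x \<partial>\<nu>)"
proof -
  have [measurable_cong]: "sets \<nu> = sets borel" using \<nu> by (simp add: prob_on_nonneg_def)
  have m: "(\<lambda>(x, \<omega>). tcp_path x \<omega> t) \<in> borel_measurable (\<nu> \<Otimes>\<^sub>M tcp_noise)"
    by (subst measurable_cong_sets[OF sets_pair_measure_cong refl]) (auto simp: prob_on_nonneg_def \<open>sets \<nu> = _\<close>)
  have "(\<integral>\<^sup>+y. f y \<partial>tcp_law \<nu> t) = (\<integral>\<^sup>+z. f (case z of (x, \<omega>) \<Rightarrow> tcp_path x \<omega> t) \<partial>(\<nu> \<Otimes>\<^sub>M tcp_noise))"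
    unfolding tcp_law_def by (rule nn_integral_distr[OF m]) simp
  also have "\<dots> = (\<integral>\<^sup>+x. tcp_semigroup f t x \<partial>\<nu>)"
    unfolding tcp_semigroup_def
    by (subst tcp_noise.nn_integral_fst[symmetric]) (use measurable_compose[OF m f] in auto)
  finally show ?thesis .
qed

lemma prob_on_nonneg_tcp_law:
  assumes \<nu>: "prob_on_nonneg \<nu>" and t: "0 \<le> t"
  shows "prob_on_nonneg (tcp_law \<nu> t)"
proof -
  have "(\<integral>\<^sup>+y. indicator {..<0} y \<partial>tcp_law \<nu> t) = (\<integral>\<^sup>+x. tcp_semigroup (indicator {..<0}) t x \<partial>\<nu>)"
    by (rule nn_integral_tcp_law[OF \<nu>]) simp
  also have "\<dots> \<le> (\<integral>\<^sup>+x. 0 \<partial>\<nu>)"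
  proof (rule nn_integral_mono_AE)
    have "AE x in \<nu>. 0 \<le> x" using \<nu> by (simp add: prob_on_nonneg_def)
    then show "AE x in \<nu>. tcp_semigroup (indicator {..<0}) t x \<le> 0"
      by eventually_elim (rule tcp_semigroup_bounded, use t in auto)
  qed
  finally have "emeasure (tcp_law \<nu> t) {..<0} = 0"
    by (simp add: tcp_law_def)
  then have "{..<0} \<in> null_sets (tcp_law \<nu> t)"
    by (auto simp: null_sets_def tcp_law_def)
  then have "AE x in tcp_law \<nu> t. 0 \<le> x"
    by (rule AE_I') auto
  then show ?thesis
    using prob_space_tcp_law[OF \<nu>] by (simp add: prob_on_nonneg_def) (simp add: tcp_law_def)
qed

text \<open>Lets the moment bound restart at \<open>t - t\<^sub>0\<close> and the contraction start
  at \<open>t\<^sub>0\<close>.\<close>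

lemma tcp_law_add:
  assumes \<nu>: "prob_on_nonneg \<nu>" and t: "0 \<le> t" and s: "0 \<le> s"
  shows "tcp_law (tcp_law \<nu> t) s = tcp_law \<nu> (t + s)"
proof (rule measure_eqI)
  show "sets (tcp_law (tcp_law \<nu> t) s) = sets (tcp_law \<nu> (t + s))" by (simp add: tcp_law_def)
  fix A assume "A \<in> sets (tcp_law (tcp_law \<nu> t) s)"
  then have [measurable]: "A \<in> sets borel" by (simp add: tcp_law_def)
  have "emeasure (tcp_law (tcp_law \<nu> t) s) A = (\<integral>\<^sup>+x. indicator A x \<partial>tcp_law (tcp_law \<nu> t) s)"
    by (simp add: tcp_law_def)
  also have "\<dots> = (\<integral>\<^sup>+x. tcp_semigroup (tcp_semigroup (indicator A) s) t x \<partial>\<nu>)"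
    by (subst nn_integral_tcp_law[OF prob_on_nonneg_tcp_law[OF \<nu> t]], simp)
      (subst nn_integral_tcp_law[OF \<nu>], simp_all)
  also have "\<dots> = (\<integral>\<^sup>+x. tcp_semigroup (indicator A) (t + s) x \<partial>\<nu>)"
  proof (rule nn_integral_cong_AE)
    have "AE x in \<nu>. 0 \<le> x" using \<nu> by (simp add: prob_on_nonneg_def)
    then show "AE x in \<nu>. tcp_semigroup (tcp_semigroup (indicator A) s) t x = tcp_semigroup (indicator A) (t + s) x"
      by eventually_elim (use t s in \<open>auto intro!: tcp_semigroup_add[symmetric] split: split_indicator\<close>)
  qed
  also have "\<dots> = (\<integral>\<^sup>+x. indicator A x \<partial>tcp_law \<nu> (t + s))"
    by (rule nn_integral_tcp_law[OF \<nu>, symmetric]) simp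
  also have "\<dots> = emeasure (tcp_law \<nu> (t + s)) A" by (simp add: tcp_law_def)
  finally show "emeasure (tcp_law (tcp_law \<nu> t) s) A = emeasure (tcp_law \<nu> (t + s)) A" .
qed

text \<open>\<open>tcp_moment_bound\<close> grows linearly in time, so it is applied only to the
  last stretch of length \<open>t\<^sub>0\<close>. Its independence of the starting point makes the
  law at \<open>t - t\<^sub>0\<close> irrelevant.\<close>

lemma tcp_law_moment:
  assumes \<nu>: "prob_on_nonneg \<nu>" and t\<^sub>0: "0 < t\<^sub>0" and t: "t\<^sub>0 \<le> t"
  shows "(\<integral>\<^sup>+y. ennreal (y ^ Suc n) \<partial>tcp_law \<nu> t) \<le>
    ennreal ((4 * real (Suc n) / t\<^sub>0) ^ Suc n + (4 * real (Suc n)) ^ Suc n * t\<^sub>0)"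
proof -
  define \<mu> where "\<mu> = tcp_law \<nu> (t - t\<^sub>0)"
  have \<mu>: "prob_on_nonneg \<mu>" unfolding \<mu>_def using \<nu> t by (intro prob_on_nonneg_tcp_law) auto
  interpret prob_space \<mu> using \<mu> by (simp add: prob_on_nonneg_def)
  have "tcp_law \<nu> t = tcp_law \<mu> t\<^sub>0"
    unfolding \<mu>_def using tcp_law_add[OF \<nu>, of "t - t\<^sub>0" t\<^sub>0] t t\<^sub>0 by simp
  then have "(\<integral>\<^sup>+y. ennreal (y ^ Suc n) \<partial>tcp_law \<nu> t) =
    (\<integral>\<^sup>+x. tcp_semigroup (\<lambda>y. ennreal (y ^ Suc n)) t\<^sub>0 x \<partial>\<mu>)"
    by (simp only:) (rule nn_integral_tcp_law[OF \<mu>], simp)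
  also have "\<dots> \<le> (\<integral>\<^sup>+x. ennreal ((4 * real (Suc n) / t\<^sub>0) ^ Suc n + (4 * real (Suc n)) ^ Suc n * t\<^sub>0) \<partial>\<mu>)"
  proof (rule nn_integral_mono_AE)
    have "AE x in \<mu>. 0 \<le> x" using \<mu> by (simp add: prob_on_nonneg_def)
    then show "AE x in \<mu>. tcp_semigroup (\<lambda>y. ennreal (y ^ Suc n)) t\<^sub>0 x \<le>
      ennreal ((4 * real (Suc n) / t\<^sub>0) ^ Suc n + (4 * real (Suc n)) ^ Suc n * t\<^sub>0)"
      by eventually_elim (rule tcp_moment_bound[OF t\<^sub>0])
  qed
  also have "\<dots> = ennreal ((4 * real (Suc n) / t\<^sub>0) ^ Suc n + (4 * real (Suc n)) ^ Suc n * t\<^sub>0)"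
    by (simp add: emeasure_space_1)
  finally show ?thesis .
qed

text \<open>The number of steps of \<open>tcp_coupling\<close> may depend on the starting point, which makes the
  truncation error uniformly small.\<close>

lemma ex_coupling_tcp_law:
  assumes \<mu>: "prob_on_nonneg \<mu>" and \<mu>': "prob_on_nonneg \<mu>'" and s: "0 \<le> s"
  shows "\<exists>\<pi>\<in>couplings (tcp_law \<mu> s) (tcp_law \<mu>' s). (\<integral>\<^sup>+z. ennreal (coupling_cost z) \<partial>\<pi>) \<le>
    ennreal (exp (- (121 / 1000) * s)) * (2 + (\<integral>\<^sup>+x. ennreal x \<partial>\<mu>) + (\<integral>\<^sup>+y. ennreal y \<partial>\<mu>'))"
proof -
  let ?e = "exp (- (121 / 1000) * s)"
  interpret M: prob_space \<mu> using \<mu> by (simp add: prob_on_nonneg_def)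
  interpret M': prob_space \<mu>' using \<mu>' by (simp add: prob_on_nonneg_def)
  interpret P: pair_prob_space \<mu> \<mu>' ..
  have sets [measurable_cong]: "sets \<mu> = sets borel" "sets \<mu>' = sets borel"
    using \<mu> \<mu>' by (simp_all add: prob_on_nonneg_def)
  have nonneg: "AE z in \<mu> \<Otimes>\<^sub>M \<mu>'. 0 \<le> fst z \<and> 0 \<le> snd z"
  proof -
    have "AE x in \<mu>. AE y in \<mu>'. 0 \<le> fst (x, y) \<and> 0 \<le> snd (x, y)"
      using \<mu> \<mu>' unfolding prob_on_nonneg_def by (auto elim!: eventually_mono)
    then show ?thesis
      by (intro P.AE_pair_measure) auto
  qed
  define err where "err n z = (1 + (max (fst z) (snd z) + s)) * ((max (fst z) (snd z) + s) * s) ^ n / fact n"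
    for n and z :: "real \<times> real"
  \<comment> \<open>The error is pushed below the decay factor \<open>?e\<close> itself. It then
    adds 1 to the bracket of the claim; with the 1 from \<open>sqrt_le_one_plus\<close> this gives
    the summand 2.\<close>
  define N where "N z = (LEAST n. err n z < ?e)" for z
  have [measurable]: "N \<in> borel \<Otimes>\<^sub>M borel \<rightarrow>\<^sub>M count_space UNIV"
    unfolding N_def[abs_def] err_def by measurable
  have N: "err (N z) z < ?e" for z
    unfolding N_def by (rule LeastI_ex) (simp add: err_def power_fact_less)
  define \<kappa> where "\<kappa> z = tcp_coupling (N z) (s, fst z, snd z)" for z
  have \<kappa>: "\<kappa> \<in> borel \<Otimes>\<^sub>M borel \<rightarrow>\<^sub>M prob_algebra (borel \<Otimes>\<^sub>M borel)"
    unfolding \<kappa>_def[abs_def]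
    by (rule measurable_compose_countable[where f = "\<lambda>n z. tcp_coupling n (s, fst z, snd z)"]) measurable
  have init: "\<mu> \<Otimes>\<^sub>M \<mu>' \<in> space (prob_algebra (borel \<Otimes>\<^sub>M borel))"
    using sets by (simp add: space_prob_algebra P.prob_space_axioms cong: sets_pair_measure_cong)
  define \<pi> where "\<pi> = bind (\<mu> \<Otimes>\<^sub>M \<mu>') \<kappa>"
  have sets_\<pi>: "sets \<pi> = sets (borel \<Otimes>\<^sub>M borel)"
    unfolding \<pi>_def by (rule sets_bind'[OF init \<kappa>])
  have prob_\<pi>: "prob_space \<pi>"
    unfolding \<pi>_def by (rule prob_space_bind'[OF init \<kappa>])
  have int_\<pi>: "(\<integral>\<^sup>+z. F z \<partial>\<pi>) = (\<integral>\<^sup>+z. \<integral>\<^sup>+a. F a \<partial>\<kappa> z \<partial>(\<mu> \<Otimes>\<^sub>M \<mu>'))"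
    if "F \<in> borel_measurable (borel \<Otimes>\<^sub>M borel)" for F
    unfolding \<pi>_def
    by (rule nn_integral_bind[OF that]) (use measurable_prob_algebraD[OF \<kappa>] in \<open>simp cong: measurable_cong_sets\<close>)
  have fst_\<pi>: "distr \<pi> borel fst = tcp_law \<mu> s"
  proof (rule measure_eqI)
    fix A assume "A \<in> sets (distr \<pi> borel fst)"
    then have A [measurable]: "A \<in> sets borel" by simp
    have "emeasure (distr \<pi> borel fst) A = (\<integral>\<^sup>+x. indicator A x \<partial>distr \<pi> borel fst)" by simp
    also have "\<dots> = (\<integral>\<^sup>+z. indicator A (fst z) \<partial>\<pi>)"
      by (rule nn_integral_distr) (simp_all add: measurable_cong_sets[OF sets_\<pi> refl])
    also have "\<dots> = (\<integral>\<^sup>+z. tcp_semigroup (indicator A) s (fst z) \<partial>(\<mu> \<Otimes>\<^sub>M \<mu>'))"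
      by (subst int_\<pi>, simp, rule nn_integral_cong_AE)
        (use nonneg in eventually_elim, unfold \<kappa>_def, rule tcp_coupling_marginals(1), use s in auto)
    also have "\<dots> = (\<integral>\<^sup>+x. tcp_semigroup (indicator A) s x \<partial>\<mu>)"
      by (subst M'.nn_integral_fst[symmetric]) (simp_all add: M'.emeasure_space_1)
    also have "\<dots> = (\<integral>\<^sup>+x. indicator A x \<partial>tcp_law \<mu> s)"
      by (rule nn_integral_tcp_law[OF \<mu>, symmetric]) simp
    also have "\<dots> = emeasure (tcp_law \<mu> s) A" by (simp add: tcp_law_def)
    finally show "emeasure (distr \<pi> borel fst) A = emeasure (tcp_law \<mu> s) A" .
  qed (simp add: tcp_law_def)
  have snd_\<pi>: "distr \<pi> borel snd = tcp_law \<mu>' s"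
  proof (rule measure_eqI)
    fix A assume "A \<in> sets (distr \<pi> borel snd)"
    then have A [measurable]: "A \<in> sets borel" by simp
    have "emeasure (distr \<pi> borel snd) A = (\<integral>\<^sup>+x. indicator A x \<partial>distr \<pi> borel snd)" by simp
    also have "\<dots> = (\<integral>\<^sup>+z. indicator A (snd z) \<partial>\<pi>)"
      by (rule nn_integral_distr) (simp_all add: measurable_cong_sets[OF sets_\<pi> refl])
    also have "\<dots> = (\<integral>\<^sup>+z. tcp_semigroup (indicator A) s (snd z) \<partial>(\<mu> \<Otimes>\<^sub>M \<mu>'))"
      by (subst int_\<pi>, simp, rule nn_integral_cong_AE)
        (use nonneg in eventually_elim, unfold \<kappa>_def, rule tcp_coupling_marginals(2), use s in auto)
    also have "\<dots> = (\<integral>\<^sup>+x. tcp_semigroup (indicator A) s x \<partial>\<mu>')"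
      by (subst M'.nn_integral_fst[symmetric]) (simp_all add: M.emeasure_space_1)
    also have "\<dots> = (\<integral>\<^sup>+x. indicator A x \<partial>tcp_law \<mu>' s)"
      by (rule nn_integral_tcp_law[OF \<mu>', symmetric]) simp
    also have "\<dots> = emeasure (tcp_law \<mu>' s) A" by (simp add: tcp_law_def)
    finally show "emeasure (distr \<pi> borel snd) A = emeasure (tcp_law \<mu>' s) A" .
  qed (simp add: tcp_law_def)
  have "(\<integral>\<^sup>+z. ennreal (coupling_cost z) \<partial>\<pi>) =
    (\<integral>\<^sup>+z. \<integral>\<^sup>+a. ennreal (coupling_cost a) \<partial>\<kappa> z \<partial>(\<mu> \<Otimes>\<^sub>M \<mu>'))"
    by (rule int_\<pi>) simp
  also have "\<dots> \<le> (\<integral>\<^sup>+z. ennreal ?e * (2 + ennreal (fst z) + ennreal (snd z)) \<partial>(\<mu> \<Otimes>\<^sub>M \<mu>'))"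
  proof (rule nn_integral_mono_AE, use nonneg in eventually_elim)
    fix z :: "real \<times> real" assume z: "0 \<le> fst z \<and> 0 \<le> snd z"
    have "coupling_cost z \<le> sqrt \<bar>fst z - snd z\<bar>"
      using z weight_le_1[of "max (fst z) (snd z)"]
      by (auto simp: coupling_cost_def intro!: mult_left_le)
    also have "\<dots> \<le> 1 + \<bar>fst z - snd z\<bar>"
      by (rule sqrt_le_one_plus) simp
    also have "\<dots> \<le> 1 + fst z + snd z" using z by auto
    finally have cost: "coupling_cost z \<le> 1 + fst z + snd z" .
    have "(\<integral>\<^sup>+a. ennreal (coupling_cost a) \<partial>\<kappa> z) \<le>
      ennreal (?e * coupling_cost z) + ennreal (err (N z) z)"
      unfolding \<kappa>_def err_def using tcp_coupling_cost_bound[OF s, of "fst z" "snd z" "N z"] z by simp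
    also have "\<dots> \<le> ennreal (?e * (1 + fst z + snd z)) + ennreal ?e"
      using cost N[of z] by (intro add_mono ennreal_leI mult_left_mono) auto
    also have "\<dots> = ennreal (?e * (2 + fst z + snd z))"
      using z by (subst ennreal_plus[symmetric]) (auto simp: algebra_simps)
    also have "\<dots> = ennreal ?e * (2 + ennreal (fst z) + ennreal (snd z))"
      using z by (simp add: ennreal_mult)
    finally show "(\<integral>\<^sup>+a. ennreal (coupling_cost a) \<partial>\<kappa> z) \<le>
      ennreal ?e * (2 + ennreal (fst z) + ennreal (snd z))" .
  qed
  also have "\<dots> = ennreal ?e * (\<integral>\<^sup>+z. 2 + ennreal (fst z) + ennreal (snd z) \<partial>(\<mu> \<Otimes>\<^sub>M \<mu>'))"
    by (rule nn_integral_cmult) simp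
  also have "(\<integral>\<^sup>+z. 2 + ennreal (fst z) + ennreal (snd z) \<partial>(\<mu> \<Otimes>\<^sub>M \<mu>')) =
    2 + (\<integral>\<^sup>+x. ennreal x \<partial>\<mu>) + (\<integral>\<^sup>+y. ennreal y \<partial>\<mu>')"
    by (subst M'.nn_integral_fst[symmetric])
      (simp_all add: nn_integral_add M.emeasure_space_1 M'.emeasure_space_1)
  finally show ?thesis
    using sets_\<pi> prob_\<pi> fst_\<pi> snd_\<pi> by (auto simp: couplings_def intro!: bexI[of _ \<pi>])
qed

section \<open>From the coupling cost to the Wasserstein distance\<close>

lemma wasserstein_le:
  assumes \<pi>: "\<pi> \<in> couplings \<mu> \<mu>'" and p: "0 < p" and A: "0 \<le> A"
    and le: "(\<integral>\<^sup>+z. ennreal (\<bar>fst z - snd z\<bar> powr p) \<partial>\<pi>) \<le> ennreal A"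
  shows "wasserstein p \<mu> \<mu>' \<le> ennreal (A powr (1 / p))"
proof -
  define c where "c = (INF \<pi>\<in>couplings \<mu> \<mu>'. \<integral>\<^sup>+(x, y). ennreal (\<bar>x - y\<bar> powr p) \<partial>\<pi>)"
  have "c \<le> (\<integral>\<^sup>+(x, y). ennreal (\<bar>x - y\<bar> powr p) \<partial>\<pi>)"
    unfolding c_def by (rule INF_lower[OF \<pi>])
  also have "\<dots> \<le> ennreal A" using le by (simp add: split_beta')
  finally have c: "c \<le> ennreal A" .
  then have "c \<noteq> \<infinity>" by (auto simp: top_unique)
  moreover have "enn2real c \<le> A"
    using c A by (rule enn2real_leI[rotated])
  ultimately show ?thesis
    using p unfolding wasserstein_def c_def[symmetric] Let_def
    by (auto intro!: ennreal_leI powr_mono2)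
qed

text \<open>Splitting at \<open>d = exp (\<eta> t)\<close> trades an arbitrarily small part of the exponential rate of
  \<open>sqrt d\<close> for a power \<open>d^p\<close>, at the price of a high moment.\<close>

lemma powr_le_sqrt_plus_power:
  fixes d p \<eta> t :: real
  assumes d: "0 \<le> d" and p: "1 \<le> p" and \<eta>: "0 \<le> \<eta>" and t: "0 \<le> t"
    and n: "b \<le> \<eta> * (real (Suc n) - p)" "p \<le> real (Suc n)"
  shows "d powr p \<le> exp (\<eta> * p * t) * sqrt d + exp (- b * t) * d ^ Suc n"
proof (cases "d = 0")
  case False
  then have d: "0 < d" using d by simp
  define R where "R = exp (\<eta> * t)"
  have R: "1 \<le> R" using \<eta> t by (simp add: R_def)
  have Rp: "R powr q = exp (\<eta> * q * t)" for q
    by (simp add: R_def powr_def mult_ac)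
  show ?thesis
  proof (cases "d \<le> R")
    case True
    have "d powr p = d powr (p - 1 / 2) * sqrt d"
      using d by (simp add: powr_half_sqrt[symmetric] flip: powr_add)
    also have "d powr (p - 1 / 2) \<le> R powr (p - 1 / 2)"
      using True d p by (intro powr_mono2) auto
    also have "\<dots> \<le> R powr p"
      using R by (intro powr_mono) auto
    finally have "d powr p \<le> R powr p * sqrt d"
      using d by (simp add: mult_right_mono)
    then show ?thesis using d by (simp add: Rp add_increasing2)
  next
    case False
    have "d powr p = d powr (p - real (Suc n)) * d ^ Suc n"
      using d by (simp add: powr_realpow[symmetric] del: of_nat_Suc power_Suc flip: powr_add)
    also have "d powr (p - real (Suc n)) \<le> R powr (p - real (Suc n))"
      using False R n by (intro powr_mono2') auto
    also have "\<dots> = exp (- (\<eta> * (real (Suc n) - p)) * t)"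
      unfolding Rp by (simp add: algebra_simps)
    also have "\<dots> \<le> exp (- b * t)"
      using n t by (simp add: mult_right_mono del: of_nat_Suc)
    finally have "d powr p \<le> exp (- b * t) * d ^ Suc n"
      using d by (simp add: mult_right_mono)
    then show ?thesis using d by (simp add: add_increasing)
  qed
qed simp

text \<open>Numerically \<open>sqrt M\<close> is about 0.9146 and \<kappa> about 0.1208, so rounding
  \<open>sqrt M\<close> down to 0.9145 and \<open>sqrt 2\<close> up to 1.4143 stays below
  0.121.\<close>

lemma rate_le:
  fixes M \<kappa> :: real
  assumes M: "M = sqrt 2 * (3 + sqrt 3) / 8" and \<kappa>: "\<kappa> = sqrt 2 * (1 - sqrt M)"
  shows "\<kappa> \<le> 121 / 1000"
proof -
  have "1414 / 1000 \<le> sqrt (2 :: real)" "1732 / 1000 \<le> sqrt (3 :: real)" and s: "sqrt 2 \<le> (14143 / 10000 :: real)"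
    by (rule real_le_rsqrt real_le_lsqrt; simp add: power2_eq_square)+
  then have "1414 / 1000 * (3 + 1732 / 1000) \<le> sqrt 2 * (3 + sqrt (3 :: real))"
    by (intro mult_mono) auto
  then have "(9145 / 10000)\<^sup>2 \<le> M" by (simp add: M power2_eq_square)
  then have M': "9145 / 10000 \<le> sqrt M" by (rule real_le_rsqrt)
  have "\<kappa> \<le> sqrt 2 * (1 - 9145 / 10000)"
    unfolding \<kappa> using M' by (intro mult_left_mono) auto
  then show ?thesis using s by simp
qed

theorem theorem1p4:
  fixes M \<kappa> \<kappa>' p t\<^sub>0 :: real
  assumes "M = sqrt 2 * (3 + sqrt 3) / 8"
    and "\<kappa> = sqrt 2 * (1 - sqrt M)"
    and "\<kappa>' < \<kappa>" and "1 \<le> p" and "0 < t\<^sub>0"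
  shows "\<exists>C::real. 0 < C \<and>
    (\<forall>\<nu> \<nu>' t. prob_on_nonneg \<nu> \<longrightarrow> prob_on_nonneg \<nu>' \<longrightarrow> t\<^sub>0 \<le> t \<longrightarrow>
       wasserstein p (tcp_law \<nu> t) (tcp_law \<nu>' t) \<le> ennreal (C * exp (- (\<kappa>' / p) * t)))"
proof -
  \<comment> \<open>Chosen so that \<open>\<eta> * p\<close> is the surplus of the proved rate over
    \<open>\<kappa>'\<close>: the factor \<open>exp (\<eta> * p * t)\<close> lost in the
    interpolation leaves exactly \<open>exp (- \<kappa>' * t)\<close>.\<close>
  define \<eta> where "\<eta> = (121 / 1000 - \<kappa>') / p"
  have \<eta>: "0 < \<eta>" and \<eta>p: "\<eta> * p = 121 / 1000 - \<kappa>'"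
    using rate_le[OF assms(1,2)] assms(3,4) by (auto simp: \<eta>_def)
  \<comment> \<open>The order of the moment that makes the part with distance above
    \<open>exp (\<eta> * t)\<close> decay at rate \<open>\<kappa>'\<close>. The maximum with
    \<open>p\<close> handles negative \<open>\<kappa>'\<close>.\<close>
  obtain n where n: "max p (p + \<kappa>' / \<eta>) \<le> real n"
    using real_arch_simple by blast
  have n1: "p \<le> real (Suc n)" and "\<kappa>' / \<eta> \<le> real (Suc n) - p"
    using n by auto
  then have n2: "\<kappa>' \<le> \<eta> * (real (Suc n) - p)"
    using \<eta> by (simp add: pos_divide_le_eq mult.commute del: of_nat_Suc)
  define mom where "mom k = (4 * real (Suc k) / t\<^sub>0) ^ Suc k + (4 * real (Suc k)) ^ Suc k * t\<^sub>0" for k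
  have mom: "0 \<le> mom k" for k
    using assms(5) by (simp add: mom_def)
  define w where "w = exp (121 / 1000 * (7 / 5) :: real)"
  \<comment> \<open>In the first summand \<open>w\<close> is the reciprocal of the smallest weight,
    and \<open>exp (121 / 1000 * t\<^sub>0)\<close> compensates for the contraction running only
    from \<open>t\<^sub>0\<close> on. The second collects the moments of order \<open>n + 1\<close>
    of both coordinates.\<close>
  define A where "A = w * exp (121 / 1000 * t\<^sub>0) * (2 + 2 * mom 0) + 2 ^ Suc n * (2 * mom n)"
  have w: "0 < w" by (simp add: w_def)
  have A: "0 < A"
    unfolding A_def using w mom by (intro add_pos_nonneg mult_pos_pos mult_nonneg_nonneg) (auto intro: add_pos_nonneg)
  show ?thesis
  proof (intro exI[of _ "A powr (1 / p)"] conjI allI impI)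
    show "0 < A powr (1 / p)" using A by simp
    fix \<nu> \<nu>' t assume \<nu>: "prob_on_nonneg \<nu>" and \<nu>': "prob_on_nonneg \<nu>'" and t: "t\<^sub>0 \<le> t"
    have t0: "0 \<le> t" using t assms(5) by simp
    have add: "tcp_law (tcp_law \<rho> t\<^sub>0) (t - t\<^sub>0) = tcp_law \<rho> t" if "prob_on_nonneg \<rho>" for \<rho>
      using tcp_law_add[OF that, of t\<^sub>0 "t - t\<^sub>0"] t assms(5) by simp
    have mean: "(\<integral>\<^sup>+x. ennreal x \<partial>tcp_law \<rho> t\<^sub>0) \<le> ennreal (mom 0)" if "prob_on_nonneg \<rho>" for \<rho>
      using tcp_law_moment[OF that assms(5) order_refl, of 0] by (simp add: mom_def)
    obtain \<pi> where \<pi>: "\<pi> \<in> couplings (tcp_law \<nu> t) (tcp_law \<nu>' t)"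
      and cost: "(\<integral>\<^sup>+z. ennreal (coupling_cost z) \<partial>\<pi>) \<le> ennreal (exp (- (121 / 1000) * (t - t\<^sub>0))) *
        (2 + (\<integral>\<^sup>+x. ennreal x \<partial>tcp_law \<nu> t\<^sub>0) + (\<integral>\<^sup>+y. ennreal y \<partial>tcp_law \<nu>' t\<^sub>0))"
      using ex_coupling_tcp_law[of "tcp_law \<nu> t\<^sub>0" "tcp_law \<nu>' t\<^sub>0" "t - t\<^sub>0"]
        prob_on_nonneg_tcp_law[OF \<nu>, of t\<^sub>0] prob_on_nonneg_tcp_law[OF \<nu>', of t\<^sub>0] t assms(5)
      unfolding add[OF \<nu>] add[OF \<nu>'] by auto
    have sets_\<pi> [measurable_cong]: "sets \<pi> = sets (borel \<Otimes>\<^sub>M borel)"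
      and fst_\<pi>: "distr \<pi> borel fst = tcp_law \<nu> t" and snd_\<pi>: "distr \<pi> borel snd = tcp_law \<nu>' t"
      using \<pi> by (auto simp: couplings_def)
    have [measurable]: "fst \<in> borel_measurable \<pi>" "snd \<in> borel_measurable \<pi>"
      by (simp_all add: measurable_cong_sets[OF sets_\<pi> refl])
    have nn1: "AE z in \<pi>. 0 \<le> fst z"
      using prob_on_nonneg_tcp_law[OF \<nu> t0] AE_distr_iff[of fst \<pi> borel "\<lambda>x. 0 \<le> x"]
      unfolding fst_\<pi> by (simp add: prob_on_nonneg_def)
    have nn2: "AE z in \<pi>. 0 \<le> snd z"
      using prob_on_nonneg_tcp_law[OF \<nu>' t0] AE_distr_iff[of snd \<pi> borel "\<lambda>x. 0 \<le> x"]
      unfolding snd_\<pi> by (simp add: prob_on_nonneg_def)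
    have m1: "(\<integral>\<^sup>+z. ennreal (fst z ^ Suc n) \<partial>\<pi>) \<le> ennreal (mom n)"
      using tcp_law_moment[OF \<nu> assms(5) t, of n] unfolding fst_\<pi>[symmetric]
      by (subst (asm) nn_integral_distr) (simp_all add: mom_def)
    have m2: "(\<integral>\<^sup>+z. ennreal (snd z ^ Suc n) \<partial>\<pi>) \<le> ennreal (mom n)"
      using tcp_law_moment[OF \<nu>' assms(5) t, of n] unfolding snd_\<pi>[symmetric]
      by (subst (asm) nn_integral_distr) (simp_all add: mom_def)
    let ?f = "exp (\<eta> * p * t) * w" and ?g = "exp (- \<kappa>' * t) * 2 ^ Suc n"
    have "(\<integral>\<^sup>+z. ennreal (\<bar>fst z - snd z\<bar> powr p) \<partial>\<pi>) \<le>
      (\<integral>\<^sup>+z. ennreal ?f * ennreal (coupling_cost z) +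
        ennreal ?g * (ennreal (fst z ^ Suc n) + ennreal (snd z ^ Suc n)) \<partial>\<pi>)"
    proof (rule nn_integral_mono_AE, use nn1 nn2 in eventually_elim)
      fix z :: "real \<times> real" assume z: "0 \<le> fst z" "0 \<le> snd z"
      let ?d = "\<bar>fst z - snd z\<bar>"
      have "sqrt ?d \<le> w * coupling_cost z"
      proof -
        have "exp (- (121 / 1000) * (7 / 5)) * sqrt ?d \<le> coupling_cost z"
          unfolding coupling_cost_def by (subst mult.commute) (intro mult_left_mono weight_bound, simp)
        then have "w * (exp (- (121 / 1000) * (7 / 5)) * sqrt ?d) \<le> w * coupling_cost z"
          using w by (intro mult_left_mono) auto
        moreover have "w * exp (- (121 / 1000) * (7 / 5)) = 1"
          unfolding w_def mult_exp_exp by simp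
        ultimately show ?thesis by (simp add: mult.assoc[symmetric])
      qed
      then have 1: "exp (\<eta> * p * t) * sqrt ?d \<le> ?f * coupling_cost z"
        by (simp add: mult.assoc)
      have "?d ^ Suc n \<le> (2 * max (fst z) (snd z)) ^ Suc n"
        using z by (intro power_mono) auto
      also have "\<dots> \<le> 2 ^ Suc n * (fst z ^ Suc n + snd z ^ Suc n)"
        unfolding power_mult_distrib using z by (intro mult_left_mono) (auto simp: max_def)
      finally have 2: "exp (- \<kappa>' * t) * ?d ^ Suc n \<le> ?g * (fst z ^ Suc n + snd z ^ Suc n)"
        by (simp only: mult.assoc mult_le_cancel_left_pos exp_gt_zero)
      have "?d powr p \<le> exp (\<eta> * p * t) * sqrt ?d + exp (- \<kappa>' * t) * ?d ^ Suc n"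
        using \<eta> t0 assms(4) n1 n2 by (intro powr_le_sqrt_plus_power) auto
      also have "\<dots> \<le> ?f * coupling_cost z + ?g * (fst z ^ Suc n + snd z ^ Suc n)"
        using 1 2 by (rule add_mono)
      finally have "ennreal (?d powr p) \<le> ennreal (?f * coupling_cost z + ?g * (fst z ^ Suc n + snd z ^ Suc n))"
        by (rule ennreal_leI)
      also have "\<dots> = ennreal (?f * coupling_cost z) + ennreal (?g * (fst z ^ Suc n + snd z ^ Suc n))"
        using z w coupling_cost_nonneg by (intro ennreal_plus) auto
      also have "\<dots> = ennreal ?f * ennreal (coupling_cost z) +
        ennreal ?g * (ennreal (fst z ^ Suc n) + ennreal (snd z ^ Suc n))"
        using z w coupling_cost_nonneg
        by (subst (1 2) ennreal_mult) (auto simp flip: ennreal_plus simp del: power_Suc)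
      finally show "ennreal (?d powr p) \<le> ennreal ?f * ennreal (coupling_cost z) +
        ennreal ?g * (ennreal (fst z ^ Suc n) + ennreal (snd z ^ Suc n))" .
    qed
    also have "\<dots> = ennreal ?f * (\<integral>\<^sup>+z. ennreal (coupling_cost z) \<partial>\<pi>) + ennreal ?g *
      ((\<integral>\<^sup>+z. ennreal (fst z ^ Suc n) \<partial>\<pi>) + (\<integral>\<^sup>+z. ennreal (snd z ^ Suc n) \<partial>\<pi>))"
      by (simp add: nn_integral_add nn_integral_cmult del: power_Suc)
    also have "\<dots> \<le> ennreal ?f * (ennreal (exp (- (121 / 1000) * (t - t\<^sub>0))) * (2 + ennreal (mom 0) + ennreal (mom 0))) +
      ennreal ?g * (ennreal (mom n) + ennreal (mom n))"
      by (intro add_mono mult_left_mono m1 m2 order.trans[OF cost] mean \<nu> \<nu>') auto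
    also have "\<dots> = ennreal (?f * (exp (- (121 / 1000) * (t - t\<^sub>0)) * (2 + mom 0 + mom 0)) + ?g * (mom n + mom n))"
    proof -
      have "ennreal (a * (b * (2 + c + c)) + e * (f + f)) =
        ennreal a * (ennreal b * (2 + ennreal c + ennreal c)) + ennreal e * (ennreal f + ennreal f)"
        if "0 \<le> a" "0 \<le> b" "0 \<le> c" "0 \<le> e" "0 \<le> f" for a b c e f
        by (simp only: that ennreal_mult ennreal_plus ennreal_numeral mult_nonneg_nonneg
          add_nonneg_nonneg zero_le_numeral)
      from this[symmetric] show ?thesis by rule (use w mom in auto)
    qed
    also have "?f * (exp (- (121 / 1000) * (t - t\<^sub>0)) * (2 + mom 0 + mom 0)) + ?g * (mom n + mom n) = A * exp (- \<kappa>' * t)"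
    proof -
      have "exp (\<eta> * p * t) * exp (- (121 / 1000) * (t - t\<^sub>0)) = exp (121 / 1000 * t\<^sub>0) * exp (- \<kappa>' * t)"
        unfolding \<eta>p mult_exp_exp by (simp add: field_simps)
      then have "?f * (exp (- (121 / 1000) * (t - t\<^sub>0)) * (2 + mom 0 + mom 0)) =
        w * (exp (121 / 1000 * t\<^sub>0) * exp (- \<kappa>' * t)) * (2 + mom 0 + mom 0)"
        by (metis mult.assoc mult.commute)
      then show ?thesis by (simp add: A_def algebra_simps)
    qed
    finally have "wasserstein p (tcp_law \<nu> t) (tcp_law \<nu>' t) \<le> ennreal ((A * exp (- \<kappa>' * t)) powr (1 / p))"
      using A assms(4) by (intro wasserstein_le[OF \<pi>]) auto
    also have "(A * exp (- \<kappa>' * t)) powr (1 / p) = A powr (1 / p) * exp (- (\<kappa>' / p) * t)"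
      using A by (simp add: powr_mult) (simp add: powr_def)
    finally show "wasserstein p (tcp_law \<nu> t) (tcp_law \<nu>' t) \<le> ennreal (A powr (1 / p) * exp (- (\<kappa>' / p) * t))" .
  qed
qed

end
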